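(* Let $\mathcal{A}$ be a category with a strict initial object, let $\mathcal{B}$ be a category, and let $\Phi \colon \mathcal{B} \to \mathcal{A}$ be a functor. Then the scone forgetful functor $U \colon \mathcal{A} \downarrow \Phi \to \mathcal{B}$ preserves effective descent morphisms.
   Context: The scone (Artin gluing) $\mathcal{A}\downarrow\Phi$ is the comma category whose objects are triples $(a, b, f)$ with $a$ an object of $\mathcal{A}$, $b$ an object of $\mathcal{B}$ and $f \colon a \to \Phi(b)$ a morphism in $\mathcal{A}$, and whose morphisms $(a,b,f)\to(a',b',f')$ are pairs $(h \colon a \to a', k \colon b \to b')$ with $f' \circ h = \Phi(k)\circ f$. The functor $U$ is the projection $(a,b,f) \mapsto b$, $(h,k)\mapsto k$. An initial object $\mathsf{0}$ of a category is strict if every object $x$ admitting a morphism $x \to \mathsf{0}$ is isomorphic to $\mathsf{0}$. A morphism $p \colon a \to b$ in a category $\mathcal{X}$ is an effective descent morphism if all pullbacks along $p$ exist in $\mathcal{X}$ (equivalently, the functor $p_! \colon \mathcal{X} \downarrow a \to \mathcal{X} \downarrow b$, $f \mapsto p \circ f$, between slice categories has a right adjoint $p^*$) and $p^*$ is monadic (its comparison functor into the Eilenberg-Moore category of the monad induced by $p_! \dashv p^*$ is an equivalence). No existence of other pullbacks in $\mathcal{X}$ is assumed. A functor $F$ preserves effective descent morphisms if $F(p)$ is an effective descent morphism whenever $p$ is. *)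

theory Defs
  imports Main
begin

section \<open>Categories\<close>

record ('o, 'm) cat =
  Obj :: "'o set"
  Arr :: "'m set"
  Dom :: "'m \<Rightarrow> 'o"
  Cod :: "'m \<Rightarrow> 'o"
  Ide :: "'o \<Rightarrow> 'm"
  Comp :: "'m \<Rightarrow> 'm \<Rightarrow> 'm"  (infixr "\<cdot>\<index>" 70)

text \<open>Composition is in applicative order, and all operations are constrained only on the
  carriers and on composable pairs of arrows.\<close>

locale category =
  fixes C :: "('o, 'm) cat" (structure)
  assumes Dom_closed: "f \<in> Arr C \<Longrightarrow> Dom C f \<in> Obj C"
    and Cod_closed: "f \<in> Arr C \<Longrightarrow> Cod C f \<in> Obj C"
    and Ide_closed: "x \<in> Obj C \<Longrightarrow> Ide C x \<in> Arr C"
    and Dom_Ide: "x \<in> Obj C \<Longrightarrow> Dom C (Ide C x) = x"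
    and Cod_Ide: "x \<in> Obj C \<Longrightarrow> Cod C (Ide C x) = x"
    and Comp_closed: "\<lbrakk>f \<in> Arr C; g \<in> Arr C; Cod C f = Dom C g\<rbrakk> \<Longrightarrow> g \<cdot> f \<in> Arr C"
    and Dom_Comp: "\<lbrakk>f \<in> Arr C; g \<in> Arr C; Cod C f = Dom C g\<rbrakk> \<Longrightarrow> Dom C (g \<cdot> f) = Dom C f"
    and Cod_Comp: "\<lbrakk>f \<in> Arr C; g \<in> Arr C; Cod C f = Dom C g\<rbrakk> \<Longrightarrow> Cod C (g \<cdot> f) = Cod C g"
    and Comp_Ide: "f \<in> Arr C \<Longrightarrow> f \<cdot> Ide C (Dom C f) = f"
    and Ide_Comp: "f \<in> Arr C \<Longrightarrow> Ide C (Cod C f) \<cdot> f = f"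
    and Comp_assoc: "\<lbrakk>f \<in> Arr C; g \<in> Arr C; h \<in> Arr C; Cod C f = Dom C g; Cod C g = Dom C h\<rbrakk>
      \<Longrightarrow> (h \<cdot> g) \<cdot> f = h \<cdot> (g \<cdot> f)"

definition Hom :: "('o, 'm) cat \<Rightarrow> 'o \<Rightarrow> 'o \<Rightarrow> 'm set" where
  "Hom C x y = {f \<in> Arr C. Dom C f = x \<and> Cod C f = y}"

definition iso_arr :: "('o, 'm) cat \<Rightarrow> 'm \<Rightarrow> bool" where
  "iso_arr C f \<longleftrightarrow> f \<in> Arr C \<and> (\<exists>g \<in> Hom C (Cod C f) (Dom C f).
     g \<cdot>\<^bsub>C\<^esub> f = Ide C (Dom C f) \<and> f \<cdot>\<^bsub>C\<^esub> g = Ide C (Cod C f))"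

definition isomorphic_obj :: "('o, 'm) cat \<Rightarrow> 'o \<Rightarrow> 'o \<Rightarrow> bool" where
  "isomorphic_obj C x y \<longleftrightarrow> (\<exists>f \<in> Hom C x y. iso_arr C f)"

definition initial_obj :: "('o, 'm) cat \<Rightarrow> 'o \<Rightarrow> bool" where
  "initial_obj C z \<longleftrightarrow> z \<in> Obj C \<and> (\<forall>x \<in> Obj C. \<exists>!f. f \<in> Hom C z x)"

definition strict_initial_obj :: "('o, 'm) cat \<Rightarrow> 'o \<Rightarrow> bool" where
  "strict_initial_obj C z \<longleftrightarrow> initial_obj C z \<and>
     (\<forall>x \<in> Obj C. Hom C x z \<noteq> {} \<longrightarrow> isomorphic_obj C x z)"

section \<open>Functors, natural transformations, equivalences\<close>

record ('o, 'm, 'p, 'n) functr =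
  FObj :: "'o \<Rightarrow> 'p"
  FArr :: "'m \<Rightarrow> 'n"

definition is_functor :: "('o, 'm) cat \<Rightarrow> ('p, 'n) cat \<Rightarrow> ('o, 'm, 'p, 'n) functr \<Rightarrow> bool" where
  "is_functor C D F \<longleftrightarrow>
     category C \<and> category D \<and>
     (\<forall>x \<in> Obj C. FObj F x \<in> Obj D) \<and>
     (\<forall>f \<in> Arr C. FArr F f \<in> Hom D (FObj F (Dom C f)) (FObj F (Cod C f))) \<and>
     (\<forall>x \<in> Obj C. FArr F (Ide C x) = Ide D (FObj F x)) \<and>
     (\<forall>f \<in> Arr C. \<forall>g \<in> Arr C. Cod C f = Dom C g \<longrightarrow>
        FArr F (g \<cdot>\<^bsub>C\<^esub> f) = FArr F g \<cdot>\<^bsub>D\<^esub> FArr F f)"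

definition id_functor :: "('o, 'm, 'o, 'm) functr" where
  "id_functor = \<lparr>FObj = \<lambda>x. x, FArr = \<lambda>f. f\<rparr>"

definition comp_functor ::
  "('p, 'n, 'q, 'k) functr \<Rightarrow> ('o, 'm, 'p, 'n) functr \<Rightarrow> ('o, 'm, 'q, 'k) functr" where
  "comp_functor G F = \<lparr>FObj = FObj G \<circ> FObj F, FArr = FArr G \<circ> FArr F\<rparr>"

definition nat_trans :: "('o, 'm) cat \<Rightarrow> ('p, 'n) cat \<Rightarrow>
    ('o, 'm, 'p, 'n) functr \<Rightarrow> ('o, 'm, 'p, 'n) functr \<Rightarrow> ('o \<Rightarrow> 'n) \<Rightarrow> bool" where
  "nat_trans C D F G \<tau> \<longleftrightarrow>
     is_functor C D F \<and> is_functor C D G \<and>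
     (\<forall>x \<in> Obj C. \<tau> x \<in> Hom D (FObj F x) (FObj G x)) \<and>
     (\<forall>f \<in> Arr C. \<tau> (Cod C f) \<cdot>\<^bsub>D\<^esub> FArr F f = FArr G f \<cdot>\<^bsub>D\<^esub> \<tau> (Dom C f))"

definition nat_iso :: "('o, 'm) cat \<Rightarrow> ('p, 'n) cat \<Rightarrow>
    ('o, 'm, 'p, 'n) functr \<Rightarrow> ('o, 'm, 'p, 'n) functr \<Rightarrow> ('o \<Rightarrow> 'n) \<Rightarrow> bool" where
  "nat_iso C D F G \<tau> \<longleftrightarrow> nat_trans C D F G \<tau> \<and> (\<forall>x \<in> Obj C. iso_arr D (\<tau> x))"

definition is_equivalence :: "('o, 'm) cat \<Rightarrow> ('p, 'n) cat \<Rightarrow> ('o, 'm, 'p, 'n) functr \<Rightarrow> bool" where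
  "is_equivalence C D F \<longleftrightarrow> is_functor C D F \<and>
     (\<exists>G \<sigma> \<tau>. is_functor D C G \<and>
        nat_iso C C id_functor (comp_functor G F) \<sigma> \<and>
        nat_iso D D (comp_functor F G) id_functor \<tau>)"

section \<open>Adjunctions, monads, monadicity\<close>

text \<open>\<open>F : C \<rightarrow> D\<close> is left adjoint to \<open>G : D \<rightarrow> C\<close> with unit \<open>\<eta>\<close> and counit \<open>\<epsilon>\<close>.\<close>

definition adjunction :: "('o, 'm) cat \<Rightarrow> ('p, 'n) cat \<Rightarrow>
    ('o, 'm, 'p, 'n) functr \<Rightarrow> ('p, 'n, 'o, 'm) functr \<Rightarrow> ('o \<Rightarrow> 'm) \<Rightarrow> ('p \<Rightarrow> 'n) \<Rightarrow> bool" where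
  "adjunction C D F G \<eta> \<epsilon> \<longleftrightarrow>
     is_functor C D F \<and> is_functor D C G \<and>
     nat_trans C C id_functor (comp_functor G F) \<eta> \<and>
     nat_trans D D (comp_functor F G) id_functor \<epsilon> \<and>
     (\<forall>x \<in> Obj C. \<epsilon> (FObj F x) \<cdot>\<^bsub>D\<^esub> FArr F (\<eta> x) = Ide D (FObj F x)) \<and>
     (\<forall>y \<in> Obj D. FArr G (\<epsilon> y) \<cdot>\<^bsub>C\<^esub> \<eta> (FObj G y) = Ide C (FObj G y))"

definition is_monad :: "('o, 'm) cat \<Rightarrow> ('o, 'm, 'o, 'm) functr \<Rightarrow>
    ('o \<Rightarrow> 'm) \<Rightarrow> ('o \<Rightarrow> 'm) \<Rightarrow> bool" where
  "is_monad C T \<eta> \<mu> \<longleftrightarrow>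
     nat_trans C C id_functor T \<eta> \<and> nat_trans C C (comp_functor T T) T \<mu> \<and>
     (\<forall>x \<in> Obj C. \<mu> x \<cdot>\<^bsub>C\<^esub> \<eta> (FObj T x) = Ide C (FObj T x)) \<and>
     (\<forall>x \<in> Obj C. \<mu> x \<cdot>\<^bsub>C\<^esub> FArr T (\<eta> x) = Ide C (FObj T x)) \<and>
     (\<forall>x \<in> Obj C. \<mu> x \<cdot>\<^bsub>C\<^esub> \<mu> (FObj T x) = \<mu> x \<cdot>\<^bsub>C\<^esub> FArr T (\<mu> x))"

definition is_algebra :: "('o, 'm) cat \<Rightarrow> ('o, 'm, 'o, 'm) functr \<Rightarrow>
    ('o \<Rightarrow> 'm) \<Rightarrow> ('o \<Rightarrow> 'm) \<Rightarrow> 'o \<times> 'm \<Rightarrow> bool" where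
  "is_algebra C T \<eta> \<mu> = (\<lambda>(x, a).
     x \<in> Obj C \<and> a \<in> Hom C (FObj T x) x \<and>
     a \<cdot>\<^bsub>C\<^esub> \<eta> x = Ide C x \<and> a \<cdot>\<^bsub>C\<^esub> \<mu> x = a \<cdot>\<^bsub>C\<^esub> FArr T a)"

text \<open>In the categories constructed below an arrow is a triple \<open>(s, h, t)\<close> that records its
  source \<open>s\<close> and target \<open>t\<close>, because the underlying datum \<open>h\<close> alone does not determine them.\<close>

definition EM :: "('o, 'm) cat \<Rightarrow> ('o, 'm, 'o, 'm) functr \<Rightarrow> ('o \<Rightarrow> 'm) \<Rightarrow> ('o \<Rightarrow> 'm) \<Rightarrow>
    ('o \<times> 'm, ('o \<times> 'm) \<times> 'm \<times> ('o \<times> 'm)) cat" where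
  "EM C T \<eta> \<mu> =
     \<lparr>Obj = {X. is_algebra C T \<eta> \<mu> X},
      Arr = {((x, a), h, (y, b)) | x a h y b.
        is_algebra C T \<eta> \<mu> (x, a) \<and> is_algebra C T \<eta> \<mu> (y, b) \<and>
        h \<in> Hom C x y \<and> h \<cdot>\<^bsub>C\<^esub> a = b \<cdot>\<^bsub>C\<^esub> FArr T h},
      Dom = (\<lambda>(X, h, Y). X),
      Cod = (\<lambda>(X, h, Y). Y),
      Ide = (\<lambda>X. (X, Ide C (fst X), X)),
      Comp = (\<lambda>(Y, k, Z) (X, h, Y'). (X, k \<cdot>\<^bsub>C\<^esub> h, Z))\<rparr>"

text \<open>The Eilenberg-Moore category of the monad \<open>(GF, \<eta>, G\<epsilon>F)\<close> induced by an adjunction, and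
  the comparison functor into it.\<close>

definition EM_adj :: "('o, 'm) cat \<Rightarrow> ('o, 'm, 'p, 'n) functr \<Rightarrow> ('p, 'n, 'o, 'm) functr \<Rightarrow>
    ('o \<Rightarrow> 'm) \<Rightarrow> ('p \<Rightarrow> 'n) \<Rightarrow> ('o \<times> 'm, ('o \<times> 'm) \<times> 'm \<times> ('o \<times> 'm)) cat" where
  "EM_adj C F G \<eta> \<epsilon> = EM C (comp_functor G F) \<eta> (\<lambda>x. FArr G (\<epsilon> (FObj F x)))"

definition comparison :: "('p, 'n) cat \<Rightarrow> ('p, 'n, 'o, 'm) functr \<Rightarrow> ('p \<Rightarrow> 'n) \<Rightarrow>
    ('p, 'n, 'o \<times> 'm, ('o \<times> 'm) \<times> 'm \<times> ('o \<times> 'm)) functr" where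
  "comparison D G \<epsilon> =
     \<lparr>FObj = \<lambda>y. (FObj G y, FArr G (\<epsilon> y)),
      FArr = \<lambda>g. ((FObj G (Dom D g), FArr G (\<epsilon> (Dom D g))),
                   FArr G g,
                   (FObj G (Cod D g), FArr G (\<epsilon> (Cod D g))))\<rparr>"

definition monadic_adjunction :: "('o, 'm) cat \<Rightarrow> ('p, 'n) cat \<Rightarrow>
    ('o, 'm, 'p, 'n) functr \<Rightarrow> ('p, 'n, 'o, 'm) functr \<Rightarrow> ('o \<Rightarrow> 'm) \<Rightarrow> ('p \<Rightarrow> 'n) \<Rightarrow> bool" where
  "monadic_adjunction C D F G \<eta> \<epsilon> \<longleftrightarrow> adjunction C D F G \<eta> \<epsilon> \<and>
     is_equivalence D (EM_adj C F G \<eta> \<epsilon>) (comparison D G \<epsilon>)"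

section \<open>Slices, pullbacks, effective descent\<close>

definition slice :: "('o, 'm) cat \<Rightarrow> 'o \<Rightarrow> ('m, 'm \<times> 'm \<times> 'm) cat" where
  "slice X b =
     \<lparr>Obj = {f \<in> Arr X. Cod X f = b},
      Arr = {(f, h, g) | f h g. f \<in> Arr X \<and> Cod X f = b \<and> g \<in> Arr X \<and> Cod X g = b \<and>
        h \<in> Hom X (Dom X f) (Dom X g) \<and> g \<cdot>\<^bsub>X\<^esub> h = f},
      Dom = (\<lambda>(f, h, g). f),
      Cod = (\<lambda>(f, h, g). g),
      Ide = (\<lambda>f. (f, Ide X (Dom X f), f)),
      Comp = (\<lambda>(g, k, e) (f, h, g'). (f, k \<cdot>\<^bsub>X\<^esub> h, e))\<rparr>"

definition slice_push :: "('o, 'm) cat \<Rightarrow> 'm \<Rightarrow> ('m, 'm \<times> 'm \<times> 'm, 'm, 'm \<times> 'm \<times> 'm) functr" where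
  "slice_push X p =
     \<lparr>FObj = \<lambda>f. p \<cdot>\<^bsub>X\<^esub> f, FArr = \<lambda>(f, h, g). (p \<cdot>\<^bsub>X\<^esub> f, h, p \<cdot>\<^bsub>X\<^esub> g)\<rparr>"

definition is_pullback :: "('o, 'm) cat \<Rightarrow> 'm \<Rightarrow> 'm \<Rightarrow> 'm \<Rightarrow> 'm \<Rightarrow> bool" where
  "is_pullback X p f u v \<longleftrightarrow>
     u \<in> Arr X \<and> v \<in> Arr X \<and> Dom X u = Dom X v \<and>
     Cod X u = Dom X p \<and> Cod X v = Dom X f \<and> p \<cdot>\<^bsub>X\<^esub> u = f \<cdot>\<^bsub>X\<^esub> v \<and>
     (\<forall>s \<in> Arr X. \<forall>t \<in> Arr X.
        Dom X s = Dom X t \<and> Cod X s = Dom X p \<and> Cod X t = Dom X f \<and> p \<cdot>\<^bsub>X\<^esub> s = f \<cdot>\<^bsub>X\<^esub> t \<longrightarrow>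
        (\<exists>!w. w \<in> Hom X (Dom X s) (Dom X u) \<and> u \<cdot>\<^bsub>X\<^esub> w = s \<and> v \<cdot>\<^bsub>X\<^esub> w = t))"

definition has_pullbacks_along :: "('o, 'm) cat \<Rightarrow> 'm \<Rightarrow> bool" where
  "has_pullbacks_along X p \<longleftrightarrow>
     (\<forall>f \<in> Arr X. Cod X f = Cod X p \<longrightarrow> (\<exists>u v. is_pullback X p f u v))"

text \<open>The witness \<open>R\<close> is the change-of-base functor \<open>p\<^sup>*\<close>; it is determined by \<open>p\<close> up to natural
  isomorphism, being right adjoint to \<open>slice_push X p\<close>.\<close>

definition effective_descent :: "('o, 'm) cat \<Rightarrow> 'm \<Rightarrow> bool" where
  "effective_descent X p \<longleftrightarrow> p \<in> Arr X \<and> has_pullbacks_along X p \<and>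
     (\<exists>R \<eta> \<epsilon>. monadic_adjunction (slice X (Dom X p)) (slice X (Cod X p)) (slice_push X p) R \<eta> \<epsilon>)"

definition preserves_effective_descent ::
    "('o, 'm) cat \<Rightarrow> ('p, 'n) cat \<Rightarrow> ('o, 'm, 'p, 'n) functr \<Rightarrow> bool" where
  "preserves_effective_descent X Y F \<longleftrightarrow>
     is_functor X Y F \<and> (\<forall>p. effective_descent X p \<longrightarrow> effective_descent Y (FArr F p))"

section \<open>The scone\<close>

definition scone :: "('a, 'm) cat \<Rightarrow> ('b, 'n) cat \<Rightarrow> ('b, 'n, 'a, 'm) functr \<Rightarrow>
    ('a \<times> 'b \<times> 'm, ('a \<times> 'b \<times> 'm) \<times> ('m \<times> 'n) \<times> ('a \<times> 'b \<times> 'm)) cat" where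
  "scone A B \<Phi> =
     \<lparr>Obj = {(a, b, f) | a b f. a \<in> Obj A \<and> b \<in> Obj B \<and> f \<in> Hom A a (FObj \<Phi> b)},
      Arr = {((a, b, f), (h, k), (a', b', f')) | a b f h k a' b' f'.
        a \<in> Obj A \<and> b \<in> Obj B \<and> f \<in> Hom A a (FObj \<Phi> b) \<and>
        a' \<in> Obj A \<and> b' \<in> Obj B \<and> f' \<in> Hom A a' (FObj \<Phi> b') \<and>
        h \<in> Hom A a a' \<and> k \<in> Hom B b b' \<and> f' \<cdot>\<^bsub>A\<^esub> h = FArr \<Phi> k \<cdot>\<^bsub>A\<^esub> f},
      Dom = (\<lambda>(s, hk, t). s),
      Cod = (\<lambda>(s, hk, t). t),
      Ide = (\<lambda>(a, b, f). ((a, b, f), (Ide A a, Ide B b), (a, b, f))),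
      Comp = (\<lambda>(t, (h', k'), u) (s, (h, k), t'). (s, (h' \<cdot>\<^bsub>A\<^esub> h, k' \<cdot>\<^bsub>B\<^esub> k), u))\<rparr>"

definition scone_forget ::
    "('a \<times> 'b \<times> 'm, ('a \<times> 'b \<times> 'm) \<times> ('m \<times> 'n) \<times> ('a \<times> 'b \<times> 'm), 'b, 'n) functr" where
  "scone_forget = \<lparr>FObj = \<lambda>(a, b, f). b, FArr = \<lambda>(s, (h, k), t). k\<rparr>"

section \<open>The constructions are well defined\<close>

lemma category_slice:
  assumes "category X"
  shows "category (slice X b)"
proof -
  interpret category X by fact
  show ?thesis
  proof (unfold_locales, goal_cases)
    case (3 f)
    then show ?case
      by (simp add: slice_def Hom_def Dom_closed Ide_closed Dom_Ide Cod_Ide Comp_Ide)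
  next
    case (6 F G)
    obtain f h g where F: "F = (f, h, g)" by (metis surj_pair)
    obtain g' k e where G: "G = (g', k, e)" by (metis surj_pair)
    have arr: "f \<in> Arr X" "g \<in> Arr X" "e \<in> Arr X" "h \<in> Arr X" "k \<in> Arr X"
      and cod: "Cod X f = b" "Cod X e = b"
      and h: "Dom X h = Dom X f" "Cod X h = Dom X g" "g \<cdot>\<^bsub>X\<^esub> h = f"
      and k: "Dom X k = Dom X g" "Cod X k = Dom X e" "e \<cdot>\<^bsub>X\<^esub> k = g" and [simp]: "g' = g"
      using 6 by (simp_all add: F G slice_def Hom_def)
    have "e \<cdot>\<^bsub>X\<^esub> (k \<cdot>\<^bsub>X\<^esub> h) = f"
      using Comp_assoc[of h k e] arr h k by simp
    then show ?case
      using arr cod h k by (simp add: F G slice_def Hom_def Comp_closed Dom_Comp Cod_Comp)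
  next
    case (9 F)
    then show ?case using Comp_Ide by (fastforce simp: slice_def Hom_def)
  next
    case (10 F)
    then show ?case using Ide_Comp by (fastforce simp: slice_def Hom_def)
  qed (auto simp: slice_def Hom_def Comp_assoc)
qed

lemma is_functor_slice_push:
  assumes "category X" "p \<in> Arr X"
  shows "is_functor (slice X (Dom X p)) (slice X (Cod X p)) (slice_push X p)"
proof -
  interpret category X by fact
  show ?thesis
    unfolding is_functor_def
  proof (intro conjI ballI impI category_slice assms(1))
    fix f assume "f \<in> Obj (slice X (Dom X p))"
    then have f: "f \<in> Arr X" "Cod X f = Dom X p" by (simp_all add: slice_def)
    show "FObj (slice_push X p) f \<in> Obj (slice X (Cod X p))"
      using f assms(2) by (simp add: slice_push_def slice_def Comp_closed Cod_Comp)
    show "FArr (slice_push X p) (Ide (slice X (Dom X p)) f) =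
        Ide (slice X (Cod X p)) (FObj (slice_push X p) f)"
      using Dom_Comp[OF f(1) assms(2) f(2)] by (simp add: slice_push_def slice_def)
  next
    fix F assume F: "F \<in> Arr (slice X (Dom X p))"
    obtain f h g where F': "F = (f, h, g)" by (metis surj_pair)
    have f: "f \<in> Arr X" "Cod X f = Dom X p" and g: "g \<in> Arr X" "Cod X g = Dom X p"
      and h: "h \<in> Arr X" "Dom X h = Dom X f" "Cod X h = Dom X g" "g \<cdot>\<^bsub>X\<^esub> h = f"
      using F by (simp_all add: F' slice_def Hom_def)
    have "(p \<cdot>\<^bsub>X\<^esub> g) \<cdot>\<^bsub>X\<^esub> h = p \<cdot>\<^bsub>X\<^esub> f"
      using Comp_assoc[OF h(1) g(1) assms(2) h(3) g(2)] h(4) by simp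
    moreover have "p \<cdot>\<^bsub>X\<^esub> f \<in> Arr X" "Dom X (p \<cdot>\<^bsub>X\<^esub> f) = Dom X f" "Cod X (p \<cdot>\<^bsub>X\<^esub> f) = Cod X p"
      "p \<cdot>\<^bsub>X\<^esub> g \<in> Arr X" "Dom X (p \<cdot>\<^bsub>X\<^esub> g) = Dom X g" "Cod X (p \<cdot>\<^bsub>X\<^esub> g) = Cod X p"
      using f g assms(2) by (simp_all add: Comp_closed Dom_Comp Cod_Comp)
    ultimately show "FArr (slice_push X p) F \<in> Hom (slice X (Cod X p))
        (FObj (slice_push X p) (Dom (slice X (Dom X p)) F))
        (FObj (slice_push X p) (Cod (slice X (Dom X p)) F))"
      using h(1-3) by (simp add: F' slice_push_def slice_def Hom_def)
  next
    fix F G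
    show "FArr (slice_push X p) (G \<cdot>\<^bsub>slice X (Dom X p)\<^esub> F) =
        FArr (slice_push X p) G \<cdot>\<^bsub>slice X (Cod X p)\<^esub> FArr (slice_push X p) F"
      by (cases F; cases G) (simp add: slice_push_def slice_def)
  qed
qed

lemma category_scone:
  assumes "is_functor B A \<Phi>"
  shows "category (scone A B \<Phi>)"
proof -
  interpret A: category A using assms by (simp add: is_functor_def)
  interpret B: category B using assms by (simp add: is_functor_def)
  have F: "FArr \<Phi> k \<in> Arr A" "Dom A (FArr \<Phi> k) = FObj \<Phi> (Dom B k)"
    "Cod A (FArr \<Phi> k) = FObj \<Phi> (Cod B k)" if "k \<in> Arr B" for k
    using assms that by (auto simp: is_functor_def Hom_def)
  have FI: "FArr \<Phi> (Ide B b) = Ide A (FObj \<Phi> b)" if "b \<in> Obj B" for b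
    using assms that by (auto simp: is_functor_def)
  have FC: "FArr \<Phi> (l \<cdot>\<^bsub>B\<^esub> k) = FArr \<Phi> l \<cdot>\<^bsub>A\<^esub> FArr \<Phi> k"
    if "k \<in> Arr B" "l \<in> Arr B" "Cod B k = Dom B l" for k l
    using assms that by (auto simp: is_functor_def)
  have unit: "f \<cdot>\<^bsub>A\<^esub> Ide A a = Ide A c \<cdot>\<^bsub>A\<^esub> f" if "f \<in> Hom A a c" for f a c
    using that A.Comp_Ide[of f] A.Ide_Comp[of f] by (simp add: Hom_def)
  have paste: "f'' \<cdot>\<^bsub>A\<^esub> (h' \<cdot>\<^bsub>A\<^esub> h) = FArr \<Phi> (k' \<cdot>\<^bsub>B\<^esub> k) \<cdot>\<^bsub>A\<^esub> f"
    if "f \<in> Hom A a (FObj \<Phi> b)" "f' \<in> Hom A a' (FObj \<Phi> b')" "f'' \<in> Hom A a'' (FObj \<Phi> b'')"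
      "h \<in> Hom A a a'" "h' \<in> Hom A a' a''" "k \<in> Hom B b b'" "k' \<in> Hom B b' b''"
      "f' \<cdot>\<^bsub>A\<^esub> h = FArr \<Phi> k \<cdot>\<^bsub>A\<^esub> f" "f'' \<cdot>\<^bsub>A\<^esub> h' = FArr \<Phi> k' \<cdot>\<^bsub>A\<^esub> f'"
    for a a' a'' b b' b'' f f' f'' h h' k k'
  proof -
    have "f'' \<cdot>\<^bsub>A\<^esub> (h' \<cdot>\<^bsub>A\<^esub> h) = (f'' \<cdot>\<^bsub>A\<^esub> h') \<cdot>\<^bsub>A\<^esub> h"
      by (rule A.Comp_assoc[symmetric]) (use that(1-7) in \<open>auto simp: Hom_def\<close>)
    also have "\<dots> = FArr \<Phi> k' \<cdot>\<^bsub>A\<^esub> (f' \<cdot>\<^bsub>A\<^esub> h)"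
      unfolding that(9) by (rule A.Comp_assoc) (use that(1-7) F in \<open>auto simp: Hom_def\<close>)
    also have "\<dots> = (FArr \<Phi> k' \<cdot>\<^bsub>A\<^esub> FArr \<Phi> k) \<cdot>\<^bsub>A\<^esub> f"
      unfolding that(8)
      by (rule A.Comp_assoc[symmetric]) (use that(1-7) F in \<open>auto simp: Hom_def\<close>)
    also have "\<dots> = FArr \<Phi> (k' \<cdot>\<^bsub>B\<^esub> k) \<cdot>\<^bsub>A\<^esub> f"
      using that(6,7) by (simp add: Hom_def FC)
    finally show ?thesis .
  qed
  show ?thesis
  proof (unfold_locales, goal_cases)
    case (6 F G)
    obtain a b f h k a' b' f' where F: "F = ((a, b, f), (h, k), (a', b', f'))"
      by (metis surj_pair)
    obtain c d e h' k' a'' b'' f'' where G: "G = ((c, d, e), (h', k'), (a'', b'', f''))"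
      by (metis surj_pair)
    have "f'' \<cdot>\<^bsub>A\<^esub> (h' \<cdot>\<^bsub>A\<^esub> h) = FArr \<Phi> (k' \<cdot>\<^bsub>B\<^esub> k) \<cdot>\<^bsub>A\<^esub> f"
      by (rule paste[of f a b f' a' b' f'' a'' b'']) (use 6 in \<open>simp_all add: F G scone_def\<close>)
    then show ?case
      using 6 by (simp add: F G scone_def Hom_def A.Comp_closed B.Comp_closed A.Dom_Comp
          A.Cod_Comp B.Dom_Comp B.Cod_Comp)
  next
    case (3 x)
    obtain a b f where x: "x = (a, b, f)" by (metis surj_pair)
    then show ?case
      using 3 unit[of f a "FObj \<Phi> b"]
      by (simp add: scone_def Hom_def A.Ide_closed B.Ide_closed A.Dom_Ide A.Cod_Ide
          B.Dom_Ide B.Cod_Ide FI)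
  next
    case (9 F)
    then show ?case using A.Comp_Ide B.Comp_Ide by (fastforce simp: scone_def Hom_def)
  next
    case (10 F)
    then show ?case using A.Ide_Comp B.Ide_Comp by (fastforce simp: scone_def Hom_def)
  qed (auto simp: scone_def Hom_def A.Comp_assoc B.Comp_assoc)
qed

lemma is_functor_scone_forget:
  assumes "is_functor B A \<Phi>"
  shows "is_functor (scone A B \<Phi>) B scone_forget"
  using assms category_scone[OF assms]
  by (auto simp: is_functor_def scone_def scone_forget_def Hom_def)

lemma category_EM:
  assumes "is_monad C T \<eta> \<mu>"
  shows "category (EM C T \<eta> \<mu>)"
proof -
  have T: "is_functor C C T" using assms by (simp add: is_monad_def nat_trans_def)
  interpret category C using T by (simp add: is_functor_def)
  have TA: "FArr T f \<in> Arr C" "Dom C (FArr T f) = FObj T (Dom C f)"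
    "Cod C (FArr T f) = FObj T (Cod C f)" if "f \<in> Arr C" for f
    using T that by (auto simp: is_functor_def Hom_def)
  have TI: "FArr T (Ide C x) = Ide C (FObj T x)" if "x \<in> Obj C" for x
    using T that by (auto simp: is_functor_def)
  have TC: "FArr T (g \<cdot>\<^bsub>C\<^esub> f) = FArr T g \<cdot>\<^bsub>C\<^esub> FArr T f"
    if "f \<in> Arr C" "g \<in> Arr C" "Cod C f = Dom C g" for f g
    using T that by (auto simp: is_functor_def)
  have unit: "Ide C x \<cdot>\<^bsub>C\<^esub> a = a \<cdot>\<^bsub>C\<^esub> FArr T (Ide C x)"
    if "x \<in> Obj C" "a \<in> Hom C (FObj T x) x" for x a
    using that Comp_Ide[of a] Ide_Comp[of a] by (simp add: Hom_def TI)
  have paste: "(k \<cdot>\<^bsub>C\<^esub> h) \<cdot>\<^bsub>C\<^esub> a = c \<cdot>\<^bsub>C\<^esub> FArr T (k \<cdot>\<^bsub>C\<^esub> h)"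
    if "a \<in> Hom C (FObj T x) x" "b \<in> Hom C (FObj T y) y" "c \<in> Hom C (FObj T z) z"
      "h \<in> Hom C x y" "k \<in> Hom C y z"
      "h \<cdot>\<^bsub>C\<^esub> a = b \<cdot>\<^bsub>C\<^esub> FArr T h" "k \<cdot>\<^bsub>C\<^esub> b = c \<cdot>\<^bsub>C\<^esub> FArr T k"
    for x y z a b c h k
  proof -
    have "(k \<cdot>\<^bsub>C\<^esub> h) \<cdot>\<^bsub>C\<^esub> a = k \<cdot>\<^bsub>C\<^esub> (h \<cdot>\<^bsub>C\<^esub> a)"
      using that by (auto simp: Hom_def Comp_assoc)
    also have "\<dots> = (k \<cdot>\<^bsub>C\<^esub> b) \<cdot>\<^bsub>C\<^esub> FArr T h"
      unfolding that(6)
      by (rule Comp_assoc[symmetric]) (use that(1-5) TA in \<open>auto simp: Hom_def\<close>)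
    also have "\<dots> = c \<cdot>\<^bsub>C\<^esub> (FArr T k \<cdot>\<^bsub>C\<^esub> FArr T h)"
      unfolding that(7) by (rule Comp_assoc) (use that(1-5) TA in \<open>auto simp: Hom_def\<close>)
    also have "\<dots> = c \<cdot>\<^bsub>C\<^esub> FArr T (k \<cdot>\<^bsub>C\<^esub> h)"
      using that(4,5) by (simp add: Hom_def TC)
    finally show ?thesis .
  qed
  show ?thesis
  proof (unfold_locales, goal_cases)
    case (3 x)
    then show ?case
      using unit by (auto simp: EM_def is_algebra_def Hom_def Ide_closed Dom_Ide Cod_Ide)
  next
    case (6 f g)
    obtain x a h y b where f: "f = ((x, a), h, (y, b))" by (metis surj_pair)
    obtain y' b' k z c where g: "g = ((y', b'), k, (z, c))" by (metis surj_pair)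
    have "(k \<cdot>\<^bsub>C\<^esub> h) \<cdot>\<^bsub>C\<^esub> a = c \<cdot>\<^bsub>C\<^esub> FArr T (k \<cdot>\<^bsub>C\<^esub> h)"
      by (rule paste[of a x b y c z]) (use 6 in \<open>simp_all add: f g EM_def is_algebra_def\<close>)
    then show ?case
      using 6 by (simp add: f g EM_def is_algebra_def Hom_def Comp_closed Dom_Comp Cod_Comp)
  qed (auto simp: EM_def Hom_def Comp_Ide Ide_Comp Comp_assoc)
qed

lemma is_monad_adjunction:
  assumes "adjunction C D F G \<eta> \<epsilon>"
  shows "is_monad C (comp_functor G F) \<eta> (\<lambda>x. FArr G (\<epsilon> (FObj F x)))"
proof -
  have F: "is_functor C D F" and G: "is_functor D C G"
    and nu: "nat_trans C C id_functor (comp_functor G F) \<eta>"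
    and ne: "nat_trans D D (comp_functor F G) id_functor \<epsilon>"
    and t1: "\<And>x. x \<in> Obj C \<Longrightarrow> \<epsilon> (FObj F x) \<cdot>\<^bsub>D\<^esub> FArr F (\<eta> x) = Ide D (FObj F x)"
    and t2: "\<And>y. y \<in> Obj D \<Longrightarrow> FArr G (\<epsilon> y) \<cdot>\<^bsub>C\<^esub> \<eta> (FObj G y) = Ide C (FObj G y)"
    using assms by (auto simp: adjunction_def)
  interpret C: category C using F by (simp add: is_functor_def)
  interpret D: category D using F by (simp add: is_functor_def)
  have FO: "FObj F x \<in> Obj D" if "x \<in> Obj C" for x using F that by (simp add: is_functor_def)
  have GO: "FObj G y \<in> Obj C" if "y \<in> Obj D" for y using G that by (simp add: is_functor_def)
  have FA: "FArr F f \<in> Arr D" "Dom D (FArr F f) = FObj F (Dom C f)"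
    "Cod D (FArr F f) = FObj F (Cod C f)" if "f \<in> Arr C" for f
    using F that by (auto simp: is_functor_def Hom_def)
  have GA: "FArr G g \<in> Arr C" "Dom C (FArr G g) = FObj G (Dom D g)"
    "Cod C (FArr G g) = FObj G (Cod D g)" if "g \<in> Arr D" for g
    using G that by (auto simp: is_functor_def Hom_def)
  have GI: "FArr G (Ide D y) = Ide C (FObj G y)" if "y \<in> Obj D" for y
    using G that by (simp add: is_functor_def)
  have GC: "FArr G (g \<cdot>\<^bsub>D\<^esub> f) = FArr G g \<cdot>\<^bsub>C\<^esub> FArr G f"
    if "f \<in> Arr D" "g \<in> Arr D" "Cod D f = Dom D g" for f g
    using G that by (simp add: is_functor_def)
  have FC: "FArr F (g \<cdot>\<^bsub>C\<^esub> f) = FArr F g \<cdot>\<^bsub>D\<^esub> FArr F f"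
    if "f \<in> Arr C" "g \<in> Arr C" "Cod C f = Dom C g" for f g
    using F that by (simp add: is_functor_def)
  have e: "\<epsilon> y \<in> Arr D" "Dom D (\<epsilon> y) = FObj F (FObj G y)" "Cod D (\<epsilon> y) = y"
    if "y \<in> Obj D" for y
    using ne that by (auto simp: nat_trans_def Hom_def comp_functor_def id_functor_def)
  have u: "\<eta> x \<in> Arr C" "Dom C (\<eta> x) = x" "Cod C (\<eta> x) = FObj G (FObj F x)"
    if "x \<in> Obj C" for x
    using nu that by (auto simp: nat_trans_def Hom_def comp_functor_def id_functor_def)
  have en: "\<epsilon> (Cod D g) \<cdot>\<^bsub>D\<^esub> FArr F (FArr G g) = g \<cdot>\<^bsub>D\<^esub> \<epsilon> (Dom D g)" if "g \<in> Arr D" for g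
    using ne that by (auto simp: nat_trans_def comp_functor_def id_functor_def)
  have Gen: "FArr G (\<epsilon> (Cod D g)) \<cdot>\<^bsub>C\<^esub> FArr G (FArr F (FArr G g)) =
      FArr G g \<cdot>\<^bsub>C\<^esub> FArr G (\<epsilon> (Dom D g))" if "g \<in> Arr D" for g
    using en[OF that] that
    by (metis GC D.Cod_closed D.Dom_closed FA GA e)
  have T: "is_functor C C (comp_functor G F)" using nu by (simp add: nat_trans_def)
  have TT: "is_functor C C (comp_functor (comp_functor G F) (comp_functor G F))"
    using T by (auto simp: is_functor_def comp_functor_def Hom_def)
  have nm: "nat_trans C C (comp_functor (comp_functor G F) (comp_functor G F)) (comp_functor G F)
      (\<lambda>x. FArr G (\<epsilon> (FObj F x)))"
    unfolding nat_trans_def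
  proof (intro conjI ballI T TT)
    fix x assume "x \<in> Obj C"
    then show "FArr G (\<epsilon> (FObj F x)) \<in> Hom C
        (FObj (comp_functor (comp_functor G F) (comp_functor G F)) x) (FObj (comp_functor G F) x)"
      using FO GA e by (simp add: Hom_def comp_functor_def)
  next
    fix f assume "f \<in> Arr C"
    then show "FArr G (\<epsilon> (FObj F (Cod C f))) \<cdot>\<^bsub>C\<^esub>
        FArr (comp_functor (comp_functor G F) (comp_functor G F)) f =
        FArr (comp_functor G F) f \<cdot>\<^bsub>C\<^esub> FArr G (\<epsilon> (FObj F (Dom C f)))"
      using Gen[of "FArr F f"] FA by (simp add: comp_functor_def)
  qed
  have m1: "FArr G (\<epsilon> (FObj F x)) \<cdot>\<^bsub>C\<^esub> FArr G (FArr F (\<eta> x)) = Ide C (FObj G (FObj F x))"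
    if "x \<in> Obj C" for x
    using that t1[OF that] GC[of "FArr F (\<eta> x)" "\<epsilon> (FObj F x)"] GI[of "FObj F x"] FO FA e u by simp
  have m2: "FArr G (\<epsilon> (FObj F x)) \<cdot>\<^bsub>C\<^esub> FArr G (\<epsilon> (FObj F (FObj G (FObj F x)))) =
      FArr G (\<epsilon> (FObj F x)) \<cdot>\<^bsub>C\<^esub> FArr G (FArr F (FArr G (\<epsilon> (FObj F x))))"
    if "x \<in> Obj C" for x
    using that Gen[of "\<epsilon> (FObj F x)"] FO e by simp
  show ?thesis
    unfolding is_monad_def using nu nm t2 m1 m2 FO by (simp add: comp_functor_def)
qed

lemma is_functor_comparison:
  assumes "adjunction C D F G \<eta> \<epsilon>"
  shows "is_functor D (EM_adj C F G \<eta> \<epsilon>) (comparison D G \<epsilon>)"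
proof -
  have F: "is_functor C D F" and G: "is_functor D C G"
    and ne: "nat_trans D D (comp_functor F G) id_functor \<epsilon>"
    and t2: "\<And>y. y \<in> Obj D \<Longrightarrow> FArr G (\<epsilon> y) \<cdot>\<^bsub>C\<^esub> \<eta> (FObj G y) = Ide C (FObj G y)"
    using assms by (auto simp: adjunction_def)
  interpret C: category C using F by (simp add: is_functor_def)
  interpret D: category D using F by (simp add: is_functor_def)
  interpret E: category "EM_adj C F G \<eta> \<epsilon>"
    unfolding EM_adj_def by (rule category_EM[OF is_monad_adjunction[OF assms]])
  have GO: "FObj G y \<in> Obj C" if "y \<in> Obj D" for y using G that by (simp add: is_functor_def)
  have FO: "FObj F x \<in> Obj D" if "x \<in> Obj C" for x using F that by (simp add: is_functor_def)
  have FA: "FArr F f \<in> Arr D" "Dom D (FArr F f) = FObj F (Dom C f)"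
    "Cod D (FArr F f) = FObj F (Cod C f)" if "f \<in> Arr C" for f
    using F that by (auto simp: is_functor_def Hom_def)
  have GA: "FArr G g \<in> Arr C" "Dom C (FArr G g) = FObj G (Dom D g)"
    "Cod C (FArr G g) = FObj G (Cod D g)" if "g \<in> Arr D" for g
    using G that by (auto simp: is_functor_def Hom_def)
  have GI: "FArr G (Ide D y) = Ide C (FObj G y)" if "y \<in> Obj D" for y
    using G that by (simp add: is_functor_def)
  have GC: "FArr G (g \<cdot>\<^bsub>D\<^esub> f) = FArr G g \<cdot>\<^bsub>C\<^esub> FArr G f"
    if "f \<in> Arr D" "g \<in> Arr D" "Cod D f = Dom D g" for f g
    using G that by (simp add: is_functor_def)
  have e: "\<epsilon> y \<in> Arr D" "Dom D (\<epsilon> y) = FObj F (FObj G y)" "Cod D (\<epsilon> y) = y"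
    if "y \<in> Obj D" for y
    using ne that by (auto simp: nat_trans_def Hom_def comp_functor_def id_functor_def)
  have en: "\<epsilon> (Cod D g) \<cdot>\<^bsub>D\<^esub> FArr F (FArr G g) = g \<cdot>\<^bsub>D\<^esub> \<epsilon> (Dom D g)" if "g \<in> Arr D" for g
    using ne that by (auto simp: nat_trans_def comp_functor_def id_functor_def)
  have Gen: "FArr G (\<epsilon> (Cod D g)) \<cdot>\<^bsub>C\<^esub> FArr G (FArr F (FArr G g)) =
      FArr G g \<cdot>\<^bsub>C\<^esub> FArr G (\<epsilon> (Dom D g))" if "g \<in> Arr D" for g
    using en[OF that] that
    by (metis GC D.Cod_closed D.Dom_closed FA GA e)
  have alg: "is_algebra C (comp_functor G F) \<eta> (\<lambda>x. FArr G (\<epsilon> (FObj F x)))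
      (FObj G y, FArr G (\<epsilon> y))" if "y \<in> Obj D" for y
    using that Gen[of "\<epsilon> y"] e GA GO t2 by (simp add: is_algebra_def Hom_def comp_functor_def)
  show ?thesis
    unfolding is_functor_def
  proof (intro conjI ballI impI D.category_axioms E.category_axioms)
    fix g assume "g \<in> Arr D"
    then show "FArr (comparison D G \<epsilon>) g \<in> Hom (EM_adj C F G \<eta> \<epsilon>)
        (FObj (comparison D G \<epsilon>) (Dom D g)) (FObj (comparison D G \<epsilon>) (Cod D g))"
      using alg[of "Dom D g"] alg[of "Cod D g"] Gen[of g] GA D.Dom_closed D.Cod_closed
      by (simp add: EM_adj_def EM_def comparison_def Hom_def comp_functor_def)
  qed (use alg in \<open>simp_all add: EM_adj_def EM_def comparison_def D.Dom_Ide D.Cod_Ide D.Dom_Comp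
        D.Cod_Comp GI GC\<close>)
qed

end

theory Submission
  imports Defs
begin

text \<open>The projection \<open>U\<close> from the scone has a left adjoint \<open>L\<close>, which sends \<open>b\<close> to \<open>(0, b, 0 \<rightarrow> \<Phi> b)\<close>, and
\<open>U L\<close> is the identity. So the base category is a full coreflective subcategory of the scone. Since
the initial object is strict, this subcategory is closed under sources: an object that maps
to some \<open>L b\<close> has a component that maps to \<open>0\<close>, hence is isomorphic to an object in the image of \<open>L\<close>.
These are the only properties of the scone that matter: every strict coreflection
(\<open>strict_coreflection\<close>) preserves effective descent morphisms (\<open>U_preserves_effective_descent\<close>).

Let \<open>p : x \<rightarrow> y\<close> be an effective descent morphism of the big category \<open>X\<close>. The slice of the small
category over \<open>U x\<close> is a strict coreflective subcategory of the slice of \<open>X\<close> over \<open>x\<close>, likewise for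
\<open>y\<close>, and composition with \<open>p\<close> restricts to composition with \<open>U p\<close>. Its right adjoint also
restricts: pulling back an object of the subcategory along \<open>p\<close> gives an object that maps to the
subcategory. Hence the induced monad restricts, and algebras (descent data) along \<open>U p\<close> are the
algebras along \<open>p\<close> whose carrier is in the subcategory. It remains to see that the object to which
such an algebra descends is in the subcategory too (\<open>counit_iso_if_G_coreflected\<close>). Call it \<open>v\<close>. It
is the quotient of an object of the subcategory, and the quotient map factors through the
coreflection \<open>L (U v) \<rightarrow> v\<close>. The factorization is constant on the same pair of arrows,
so it extends to \<open>v \<rightarrow> L (U v)\<close>, and strictness applies to \<open>v\<close>.

Monadicity is used through its elementary form \<open>monadic_iff\<close>. Pullbacks along \<open>U p\<close> need not be
constructed, because a right adjoint of composition with an arrow computes them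
(\<open>right_adjoint_slice_push_imp_pullbacks\<close>).\<close>

section \<open>Isomorphisms and functors\<close>

context category
begin

declare Dom_closed [simp] Cod_closed [simp] Ide_closed [simp] Dom_Ide [simp] Cod_Ide [simp]
  Comp_closed [simp] Dom_Comp [simp] Cod_Comp [simp] Comp_Ide [simp] Ide_Comp [simp]
  Comp_assoc [simp]

lemma Comp_Ide' [simp]: "\<lbrakk>f \<in> Arr C; Dom C f = x\<rbrakk> \<Longrightarrow> f \<cdot> Ide C x = f"
  and Ide_Comp' [simp]: "\<lbrakk>f \<in> Arr C; Cod C f = x\<rbrakk> \<Longrightarrow> Ide C x \<cdot> f = f"
  by auto

lemma iso_arrI:
  assumes "f \<in> Hom C x y" "g \<in> Hom C y x" "g \<cdot> f = Ide C x" "f \<cdot> g = Ide C y"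
  shows "iso_arr C f"
  using assms unfolding iso_arr_def Hom_def by auto

lemma iso_arr_Ide [simp]: "x \<in> Obj C \<Longrightarrow> iso_arr C (Ide C x)"
  by (rule iso_arrI[of _ x x "Ide C x"]) (simp_all add: Hom_def)

lemma iso_arrE:
  assumes "iso_arr C f"
  obtains g where "g \<in> Arr C" "Dom C g = Cod C f" "Cod C g = Dom C f"
    "g \<cdot> f = Ide C (Dom C f)" "f \<cdot> g = Ide C (Cod C f)"
  using assms unfolding iso_arr_def Hom_def by auto

lemma iso_arr_closed: "iso_arr C f \<Longrightarrow> f \<in> Arr C"
  by (simp add: iso_arr_def)

lemma iso_arr_cancel_right:
  assumes "iso_arr C f" "r \<in> Arr C" "s \<in> Arr C" "Dom C r = Cod C f" "Dom C s = Cod C f"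
    and eq: "r \<cdot> f = s \<cdot> f"
  shows "r = s"
proof -
  obtain g where g: "g \<in> Arr C" "Dom C g = Cod C f" "Cod C g = Dom C f" "f \<cdot> g = Ide C (Cod C f)"
    using assms(1) by (rule iso_arrE)
  have "r = (r \<cdot> f) \<cdot> g" using assms(1-5) g iso_arr_closed[OF assms(1)] by simp
  also have "\<dots> = s" unfolding eq using assms(1-5) g iso_arr_closed[OF assms(1)] by simp
  finally show ?thesis .
qed

lemma iso_arr_cancel_left:
  assumes "iso_arr C f" "r \<in> Arr C" "s \<in> Arr C" "Cod C r = Dom C f" "Cod C s = Dom C f"
    and eq: "f \<cdot> r = f \<cdot> s"
  shows "r = s"
proof -
  obtain g where g: "g \<in> Arr C" "Dom C g = Cod C f" "Cod C g = Dom C f" "g \<cdot> f = Ide C (Dom C f)"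
    using assms(1) by (rule iso_arrE)
  note f = iso_arr_closed[OF assms(1)]
  have "r = (g \<cdot> f) \<cdot> r" unfolding g(4) using assms(1-5) by simp
  also have "\<dots> = g \<cdot> (f \<cdot> s)" unfolding eq[symmetric] using assms(1-5) f g(1-3) by simp
  also have "\<dots> = (g \<cdot> f) \<cdot> s" using assms(1-5) f g(1-3) by simp
  also have "\<dots> = s" unfolding g(4) using assms(1-5) by simp
  finally show ?thesis .
qed

lemma iso_arr_Comp:
  assumes "iso_arr C f" "iso_arr C g" "Cod C f = Dom C g"
  shows "iso_arr C (g \<cdot> f)"
proof -
  obtain f' where f': "f' \<in> Arr C" "Dom C f' = Cod C f" "Cod C f' = Dom C f"
    "f' \<cdot> f = Ide C (Dom C f)" "f \<cdot> f' = Ide C (Cod C f)"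
    using assms(1) by (rule iso_arrE)
  obtain g' where g': "g' \<in> Arr C" "Dom C g' = Cod C g" "Cod C g' = Dom C g"
    "g' \<cdot> g = Ide C (Dom C g)" "g \<cdot> g' = Ide C (Cod C g)"
    using assms(2) by (rule iso_arrE)
  note c = iso_arr_closed[OF assms(1)] iso_arr_closed[OF assms(2)] assms(3)
  have "(f' \<cdot> g') \<cdot> (g \<cdot> f) = f' \<cdot> (g' \<cdot> g) \<cdot> f"
    using c f'(1-3) g'(1-3) by simp
  also have "\<dots> = Ide C (Dom C f)" unfolding g'(4) using c f' by simp
  finally have 1: "(f' \<cdot> g') \<cdot> (g \<cdot> f) = Ide C (Dom C f)" .
  have "(g \<cdot> f) \<cdot> (f' \<cdot> g') = g \<cdot> (f \<cdot> f') \<cdot> g'"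
    using c f'(1-3) g'(1-3) by simp
  also have "\<dots> = Ide C (Cod C g)" unfolding f'(5) using c g' by simp
  finally have 2: "(g \<cdot> f) \<cdot> (f' \<cdot> g') = Ide C (Cod C g)" .
  show ?thesis
    by (rule iso_arrI[OF _ _ 1 2]) (use c f' g' in \<open>simp_all add: Hom_def\<close>)
qed

end

locale functor_between =
  fixes C :: "('o, 'm) cat" and D :: "('p, 'n) cat" and F :: "('o, 'm, 'p, 'n) functr"
  assumes is_functor: "is_functor C D F"
begin

sublocale Src: category C
  using is_functor by (simp add: is_functor_def)

sublocale Tgt: category D
  using is_functor by (simp add: is_functor_def)

lemma FObj_closed [simp]: "x \<in> Obj C \<Longrightarrow> FObj F x \<in> Obj D"
  using is_functor by (simp add: is_functor_def)

lemma FArr_closed [simp]: "f \<in> Arr C \<Longrightarrow> FArr F f \<in> Arr D"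
  and Dom_FArr [simp]: "f \<in> Arr C \<Longrightarrow> Dom D (FArr F f) = FObj F (Dom C f)"
  and Cod_FArr [simp]: "f \<in> Arr C \<Longrightarrow> Cod D (FArr F f) = FObj F (Cod C f)"
  using is_functor by (auto simp: is_functor_def Hom_def)

lemma FArr_Ide [simp]: "x \<in> Obj C \<Longrightarrow> FArr F (Ide C x) = Ide D (FObj F x)"
  using is_functor by (simp add: is_functor_def)

lemma FArr_Comp [simp]:
  "\<lbrakk>f \<in> Arr C; g \<in> Arr C; Cod C f = Dom C g\<rbrakk> \<Longrightarrow>
    FArr F (g \<cdot>\<^bsub>C\<^esub> f) = FArr F g \<cdot>\<^bsub>D\<^esub> FArr F f"
  using is_functor by (simp add: is_functor_def)

lemma iso_arr_FArr:
  assumes "iso_arr C f"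
  shows "iso_arr D (FArr F f)"
proof -
  obtain g where g: "g \<in> Arr C" "Dom C g = Cod C f" "Cod C g = Dom C f"
    "g \<cdot>\<^bsub>C\<^esub> f = Ide C (Dom C f)" "f \<cdot>\<^bsub>C\<^esub> g = Ide C (Cod C f)"
    using assms by (rule Src.iso_arrE)
  have f: "f \<in> Arr C" using assms by (rule Src.iso_arr_closed)
  show ?thesis
    by (rule Tgt.iso_arrI[of _ "FObj F (Dom C f)" "FObj F (Cod C f)" "FArr F g"])
      (use f g FArr_Comp[of f g] FArr_Comp[of g f] in \<open>simp_all add: Hom_def del: FArr_Comp\<close>)
qed

end

section \<open>Equivalences are the fully faithful essentially surjective functors\<close>

text \<open>Monadicity asks for a pseudo-inverse of the comparison functor, which is awkward to carry from one
adjunction to another. Full faithfulness and essential surjectivity are statements about single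
arrows and objects and can be carried over one at a time.\<close>

definition fully_faithful :: "('o, 'm) cat \<Rightarrow> ('p, 'n) cat \<Rightarrow> ('o, 'm, 'p, 'n) functr \<Rightarrow> bool" where
  "fully_faithful C D F \<longleftrightarrow>
     (\<forall>x \<in> Obj C. \<forall>y \<in> Obj C. bij_betw (FArr F) (Hom C x y) (Hom D (FObj F x) (FObj F y)))"

definition essentially_surjective ::
    "('o, 'm) cat \<Rightarrow> ('p, 'n) cat \<Rightarrow> ('o, 'm, 'p, 'n) functr \<Rightarrow> bool" where
  "essentially_surjective C D F \<longleftrightarrow> (\<forall>y \<in> Obj D. \<exists>x \<in> Obj C. isomorphic_obj D (FObj F x) y)"

lemma equivalence_imp_fully_faithful:
  assumes "is_equivalence C D F"
  shows "fully_faithful C D F"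
proof -
  obtain G \<sigma> \<tau> where FF: "is_functor C D F" and GG: "is_functor D C G"
    and s: "nat_iso C C id_functor (comp_functor G F) \<sigma>"
    and t: "nat_iso D D (comp_functor F G) id_functor \<tau>"
    using assms by (auto simp: is_equivalence_def)
  interpret F: functor_between C D F by unfold_locales (rule FF)
  interpret G: functor_between D C G by unfold_locales (rule GG)
  have s1: "\<sigma> x \<in> Arr C" "Dom C (\<sigma> x) = x" "Cod C (\<sigma> x) = FObj G (FObj F x)" "iso_arr C (\<sigma> x)"
    if "x \<in> Obj C" for x
    using s that by (auto simp: nat_iso_def nat_trans_def Hom_def id_functor_def comp_functor_def)
  have s2: "\<sigma> (Cod C f) \<cdot>\<^bsub>C\<^esub> f = FArr G (FArr F f) \<cdot>\<^bsub>C\<^esub> \<sigma> (Dom C f)" if "f \<in> Arr C" for f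
    using s that by (auto simp: nat_iso_def nat_trans_def id_functor_def comp_functor_def)
  have t1: "\<tau> y \<in> Arr D" "Dom D (\<tau> y) = FObj F (FObj G y)" "Cod D (\<tau> y) = y" "iso_arr D (\<tau> y)"
    if "y \<in> Obj D" for y
    using t that by (auto simp: nat_iso_def nat_trans_def Hom_def id_functor_def comp_functor_def)
  have t2: "\<tau> (Cod D f) \<cdot>\<^bsub>D\<^esub> FArr F (FArr G f) = f \<cdot>\<^bsub>D\<^esub> \<tau> (Dom D f)" if "f \<in> Arr D" for f
    using t that by (auto simp: nat_iso_def nat_trans_def id_functor_def comp_functor_def)
  have F_faithful: "r = r'"
    if "r \<in> Hom C x y" "r' \<in> Hom C x y" "FArr F r = FArr F r'" for r r' x y
    by (rule F.Src.iso_arr_cancel_left[OF s1(4)[of y]])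
      (use that s1 s2[of r] s2[of r'] in \<open>auto simp: Hom_def\<close>)
  have G_faithful: "r = r'"
    if "r \<in> Hom D x y" "r' \<in> Hom D x y" "FArr G r = FArr G r'" for r r' x y
    by (rule F.Tgt.iso_arr_cancel_right[OF t1(4)[of x]])
      (use that t1 t2[of r] t2[of r'] in \<open>auto simp: Hom_def\<close>)
  have F_full: "\<exists>r \<in> Hom C x y. FArr F r = h"
    if x: "x \<in> Obj C" and y: "y \<in> Obj C" and h: "h \<in> Hom D (FObj F x) (FObj F y)" for x y h
  proof -
    obtain i where i: "i \<in> Arr C" "Dom C i = Cod C (\<sigma> y)" "Cod C i = Dom C (\<sigma> y)"
      "\<sigma> y \<cdot>\<^bsub>C\<^esub> i = Ide C (Cod C (\<sigma> y))"
      using s1(4)[OF y] by (rule F.Src.iso_arrE)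
    define r where "r = i \<cdot>\<^bsub>C\<^esub> FArr G h \<cdot>\<^bsub>C\<^esub> \<sigma> x"
    have r: "r \<in> Arr C" "Dom C r = x" "Cod C r = y"
      using h i s1[OF x] s1[OF y] by (simp_all add: r_def Hom_def)
    have "FArr G (FArr F r) \<cdot>\<^bsub>C\<^esub> \<sigma> x = \<sigma> y \<cdot>\<^bsub>C\<^esub> r" using s2[OF r(1)] r by simp
    also have "\<dots> = (\<sigma> y \<cdot>\<^bsub>C\<^esub> i) \<cdot>\<^bsub>C\<^esub> FArr G h \<cdot>\<^bsub>C\<^esub> \<sigma> x"
      unfolding r_def using h i(1-3) s1[OF x] s1[OF y] by (simp add: Hom_def)
    also have "\<dots> = FArr G h \<cdot>\<^bsub>C\<^esub> \<sigma> x"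
      unfolding i(4) using h s1[OF x] s1[OF y] by (simp add: Hom_def)
    finally have "FArr G (FArr F r) = FArr G h"
      by (rule F.Src.iso_arr_cancel_right[OF s1(4)[OF x], rotated -1])
        (use h r s1[OF x] in \<open>simp_all add: Hom_def\<close>)
    then have "FArr F r = h"
      by (rule G_faithful[rotated -1, of _ _ "FObj F x" "FObj F y"])
        (use h r in \<open>simp_all add: Hom_def\<close>)
    then show ?thesis using r by (auto simp: Hom_def)
  qed
  show ?thesis
    unfolding fully_faithful_def bij_betw_def
  proof (intro ballI conjI)
    fix x y assume x: "x \<in> Obj C" and y: "y \<in> Obj C"
    show "inj_on (FArr F) (Hom C x y)" using F_faithful by (auto intro: inj_onI)
    show "FArr F ` Hom C x y = Hom D (FObj F x) (FObj F y)"
      using F_full[OF x y] by (auto simp: Hom_def image_iff)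
  qed
qed

lemma equivalence_imp_essentially_surjective:
  assumes "is_equivalence C D F"
  shows "essentially_surjective C D F"
proof -
  obtain G \<tau> where GG: "is_functor D C G" and t: "nat_iso D D (comp_functor F G) id_functor \<tau>"
    using assms by (auto simp: is_equivalence_def)
  interpret G: functor_between D C G by unfold_locales (rule GG)
  show ?thesis
    unfolding essentially_surjective_def
  proof
    fix y assume y: "y \<in> Obj D"
    have "isomorphic_obj D (FObj F (FObj G y)) y"
      using t y by (auto simp: nat_iso_def nat_trans_def isomorphic_obj_def comp_functor_def
          id_functor_def)
    then show "\<exists>x \<in> Obj C. isomorphic_obj D (FObj F x) y" using y G.FObj_closed by blast
  qed
qed

text \<open>The pseudo-inverse chooses, for each \<open>y\<close>, an object \<open>g y\<close> and an isomorphism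
\<open>t y : F (g y) \<rightarrow> y\<close>. Arrows \<open>x \<rightarrow> g y\<close> then correspond bijectively to arrows \<open>F x \<rightarrow> y\<close>, by
applying \<open>F\<close> and composing with \<open>t y\<close>, and this determines the action of the pseudo-inverse on
arrows, its functoriality, and the natural isomorphisms.\<close>

lemma fully_faithful_essentially_surjective_imp_equivalence:
  assumes FF: "is_functor C D F" and ff: "fully_faithful C D F"
    and es: "essentially_surjective C D F"
  shows "is_equivalence C D F"
proof -
  interpret F: functor_between C D F by unfold_locales (rule FF)
  have full: "\<exists>r \<in> Hom C x y. FArr F r = h"
    if "x \<in> Obj C" "y \<in> Obj C" "h \<in> Hom D (FObj F x) (FObj F y)" for x y h
    using ff that unfolding fully_faithful_def bij_betw_def by (metis imageE)
  have faithful: "r = r'"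
    if "r \<in> Arr C" "r' \<in> Arr C" "Dom C r = Dom C r'" "Cod C r = Cod C r'" "FArr F r = FArr F r'"
    for r r'
  proof -
    have "inj_on (FArr F) (Hom C (Dom C r) (Cod C r))"
      using ff that by (auto simp: fully_faithful_def bij_betw_def)
    then show ?thesis using that by (auto simp: inj_on_def Hom_def)
  qed
  have "\<forall>y \<in> Obj D. \<exists>x t. x \<in> Obj C \<and> t \<in> Hom D (FObj F x) y \<and> iso_arr D t"
    using es unfolding essentially_surjective_def isomorphic_obj_def by blast
  then obtain g t where g [simp]: "\<And>y. y \<in> Obj D \<Longrightarrow> g y \<in> Obj C"
    and t': "\<And>y. y \<in> Obj D \<Longrightarrow> t y \<in> Hom D (FObj F (g y)) y"
    and t_iso: "\<And>y. y \<in> Obj D \<Longrightarrow> iso_arr D (t y)"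
    by metis
  have t [simp]: "t y \<in> Arr D" "Dom D (t y) = FObj F (g y)" "Cod D (t y) = y"
    if "y \<in> Obj D" for y using t'[OF that] by (auto simp: Hom_def)
  \<comment> \<open>Since \<open>t y\<close> is invertible and \<open>F\<close> is full, every arrow into \<open>y\<close> out of the image of \<open>F\<close>
    is the image of an arrow into \<open>g y\<close>, followed by \<open>t y\<close>.\<close>
  have lift: "\<exists>r \<in> Hom C x (g y). t y \<cdot>\<^bsub>D\<^esub> FArr F r = k"
    if x: "x \<in> Obj C" and y: "y \<in> Obj D" and k: "k \<in> Hom D (FObj F x) y" for x y k
  proof -
    obtain i where i: "i \<in> Arr D" "Dom D i = Cod D (t y)" "Cod D i = Dom D (t y)"
      "t y \<cdot>\<^bsub>D\<^esub> i = Ide D (Cod D (t y))"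
      using t_iso[OF y] by (rule F.Tgt.iso_arrE)
    obtain r where r: "r \<in> Hom C x (g y)" "FArr F r = i \<cdot>\<^bsub>D\<^esub> k"
      using full[of x "g y" "i \<cdot>\<^bsub>D\<^esub> k"] x y k i by (auto simp: Hom_def)
    have "t y \<cdot>\<^bsub>D\<^esub> FArr F r = (t y \<cdot>\<^bsub>D\<^esub> i) \<cdot>\<^bsub>D\<^esub> k"
      using r(2) y i(1-3) k by (simp add: Hom_def)
    also have "\<dots> = k" unfolding i(4) using y k by (simp add: Hom_def)
    finally show ?thesis using r by blast
  qed
  have lift_unique: "r = r'"
    if "y \<in> Obj D" "r \<in> Hom C x (g y)" "r' \<in> Hom C x (g y)"
      "t y \<cdot>\<^bsub>D\<^esub> FArr F r = t y \<cdot>\<^bsub>D\<^esub> FArr F r'" for x y r r'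
  proof (rule faithful)
    show "FArr F r = FArr F r'"
      by (rule F.Tgt.iso_arr_cancel_left[OF t_iso[of y]])
        (use that in \<open>auto simp: Hom_def\<close>)
  qed (use that in \<open>auto simp: Hom_def\<close>)
  have "\<exists>r. r \<in> Hom C (g (Dom D k)) (g (Cod D k)) \<and>
      t (Cod D k) \<cdot>\<^bsub>D\<^esub> FArr F r = k \<cdot>\<^bsub>D\<^esub> t (Dom D k)" if "k \<in> Arr D" for k
    using lift[of "g (Dom D k)" "Cod D k" "k \<cdot>\<^bsub>D\<^esub> t (Dom D k)"] that by (auto simp: Hom_def)
  then obtain ga where ga': "\<And>k. k \<in> Arr D \<Longrightarrow> ga k \<in> Hom C (g (Dom D k)) (g (Cod D k))"
    and ga_eq: "\<And>k. k \<in> Arr D \<Longrightarrow>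
      t (Cod D k) \<cdot>\<^bsub>D\<^esub> FArr F (ga k) = k \<cdot>\<^bsub>D\<^esub> t (Dom D k)"
    by metis
  have ga [simp]: "ga k \<in> Arr C" "Dom C (ga k) = g (Dom D k)" "Cod C (ga k) = g (Cod D k)"
    if "k \<in> Arr D" for k using ga'[OF that] by (auto simp: Hom_def)
  define G where "G = \<lparr>FObj = g, FArr = ga\<rparr>"
  have GG: "is_functor D C G"
    unfolding is_functor_def
  proof (intro conjI ballI impI F.Src.category_axioms F.Tgt.category_axioms)
    fix y assume y: "y \<in> Obj D"
    then show "FObj G y \<in> Obj C" by (simp add: G_def)
    have "ga (Ide D y) = Ide C (g y)"
      by (rule lift_unique[of y _ "g y"])
        (use y ga_eq[of "Ide D y"] in \<open>simp_all add: Hom_def\<close>)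
    then show "FArr G (Ide D y) = Ide C (FObj G y)" by (simp add: G_def)
  next
    fix k assume "k \<in> Arr D"
    then show "FArr G k \<in> Hom C (FObj G (Dom D k)) (FObj G (Cod D k))"
      by (simp add: G_def Hom_def)
  next
    fix k l assume kl: "k \<in> Arr D" "l \<in> Arr D" "Cod D k = Dom D l"
    have "t (Cod D l) \<cdot>\<^bsub>D\<^esub> FArr F (ga l \<cdot>\<^bsub>C\<^esub> ga k) =
        (t (Cod D l) \<cdot>\<^bsub>D\<^esub> FArr F (ga l)) \<cdot>\<^bsub>D\<^esub> FArr F (ga k)"
      using kl by simp
    also have "\<dots> = l \<cdot>\<^bsub>D\<^esub> t (Cod D k) \<cdot>\<^bsub>D\<^esub> FArr F (ga k)"
      unfolding ga_eq[OF kl(2)] using kl by simp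
    also have "\<dots> = (l \<cdot>\<^bsub>D\<^esub> k) \<cdot>\<^bsub>D\<^esub> t (Dom D k)"
      unfolding ga_eq[OF kl(1)] using kl by simp
    finally have "ga (l \<cdot>\<^bsub>D\<^esub> k) = ga l \<cdot>\<^bsub>C\<^esub> ga k"
      by (intro lift_unique[of "Cod D l" _ "g (Dom D k)"])
        (use kl ga_eq[of "l \<cdot>\<^bsub>D\<^esub> k"] in \<open>simp_all add: Hom_def\<close>)
    then show "FArr G (l \<cdot>\<^bsub>D\<^esub> k) = FArr G l \<cdot>\<^bsub>C\<^esub> FArr G k" by (simp add: G_def)
  qed
  have "\<exists>r. r \<in> Hom C x (g (FObj F x)) \<and> t (FObj F x) \<cdot>\<^bsub>D\<^esub> FArr F r = Ide D (FObj F x)"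
    if "x \<in> Obj C" for x
    using lift[of x "FObj F x" "Ide D (FObj F x)"] that by (auto simp: Hom_def)
  then obtain s where s': "\<And>x. x \<in> Obj C \<Longrightarrow> s x \<in> Hom C x (g (FObj F x))"
    and s_eq: "\<And>x. x \<in> Obj C \<Longrightarrow> t (FObj F x) \<cdot>\<^bsub>D\<^esub> FArr F (s x) = Ide D (FObj F x)"
    by metis
  have s [simp]: "s x \<in> Arr C" "Dom C (s x) = x" "Cod C (s x) = g (FObj F x)"
    if "x \<in> Obj C" for x using s'[OF that] by (auto simp: Hom_def)
  have s_iso: "iso_arr C (s x)" if x: "x \<in> Obj C" for x
  proof -
    obtain i where i': "i \<in> Hom C (g (FObj F x)) x" "FArr F i = t (FObj F x)"
      using full[of "g (FObj F x)" x "t (FObj F x)"] x by (auto simp: Hom_def)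
    then have i: "i \<in> Arr C" "Dom C i = g (FObj F x)" "Cod C i = x" by (auto simp: Hom_def)
    have 1: "i \<cdot>\<^bsub>C\<^esub> s x = Ide C x"
      by (rule faithful) (use x i i'(2) s_eq[OF x] in simp_all)
    have "t (FObj F x) \<cdot>\<^bsub>D\<^esub> FArr F (s x \<cdot>\<^bsub>C\<^esub> i) =
        (t (FObj F x) \<cdot>\<^bsub>D\<^esub> FArr F (s x)) \<cdot>\<^bsub>D\<^esub> t (FObj F x)"
      using x i i'(2) by simp
    also have "\<dots> = t (FObj F x) \<cdot>\<^bsub>D\<^esub> FArr F (Ide C (g (FObj F x)))"
      unfolding s_eq[OF x] using x by simp
    finally have 2: "s x \<cdot>\<^bsub>C\<^esub> i = Ide C (g (FObj F x))"
      by (intro lift_unique[of "FObj F x" _ "g (FObj F x)"])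
        (use x i in \<open>simp_all add: Hom_def\<close>)
    show ?thesis
      by (rule F.Src.iso_arrI[OF _ i'(1) 1 2]) (use x in \<open>simp add: Hom_def\<close>)
  qed
  have s_nat: "s (Cod C f) \<cdot>\<^bsub>C\<^esub> f = ga (FArr F f) \<cdot>\<^bsub>C\<^esub> s (Dom C f)"
    if f: "f \<in> Arr C" for f
  proof (rule lift_unique[of "FObj F (Cod C f)" _ "Dom C f"])
    let ?t = "t (FObj F (Cod C f))"
    have "?t \<cdot>\<^bsub>D\<^esub> FArr F (s (Cod C f) \<cdot>\<^bsub>C\<^esub> f) =
        (?t \<cdot>\<^bsub>D\<^esub> FArr F (s (Cod C f))) \<cdot>\<^bsub>D\<^esub> FArr F f"
      using f by simp
    also have "\<dots> = FArr F f" using f s_eq[of "Cod C f"] by simp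
    finally have 1: "?t \<cdot>\<^bsub>D\<^esub> FArr F (s (Cod C f) \<cdot>\<^bsub>C\<^esub> f) = FArr F f" .
    have "?t \<cdot>\<^bsub>D\<^esub> FArr F (ga (FArr F f) \<cdot>\<^bsub>C\<^esub> s (Dom C f)) =
        (?t \<cdot>\<^bsub>D\<^esub> FArr F (ga (FArr F f))) \<cdot>\<^bsub>D\<^esub> FArr F (s (Dom C f))"
      using f by simp
    also have "\<dots> = FArr F f \<cdot>\<^bsub>D\<^esub> t (FObj F (Dom C f)) \<cdot>\<^bsub>D\<^esub> FArr F (s (Dom C f))"
      using f ga_eq[of "FArr F f"] by simp
    also have "\<dots> = FArr F f" using f s_eq[of "Dom C f"] by simp
    finally show "?t \<cdot>\<^bsub>D\<^esub> FArr F (s (Cod C f) \<cdot>\<^bsub>C\<^esub> f) =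
        ?t \<cdot>\<^bsub>D\<^esub> FArr F (ga (FArr F f) \<cdot>\<^bsub>C\<^esub> s (Dom C f))"
      using 1 by simp
  qed (use f in \<open>simp_all add: Hom_def\<close>)
  have "is_functor C C (comp_functor G F)" "is_functor D D (comp_functor F G)"
    "is_functor C C id_functor" "is_functor D D id_functor"
    using FF GG by (auto simp: is_functor_def comp_functor_def id_functor_def Hom_def)
  then have "nat_iso C C id_functor (comp_functor G F) s" "nat_iso D D (comp_functor F G) id_functor t"
    using s_iso s_nat t_iso ga_eq s' t'
    by (auto simp: nat_iso_def nat_trans_def id_functor_def comp_functor_def G_def)
  then show ?thesis using FF GG by (auto simp: is_equivalence_def)
qed

section \<open>Adjunctions and monadicity\<close>

locale adjoint_functors =
  fixes C :: "('o, 'm) cat" and D :: "('p, 'n) cat"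
    and F :: "('o, 'm, 'p, 'n) functr" and G :: "('p, 'n, 'o, 'm) functr"
    and \<eta> :: "'o \<Rightarrow> 'm" and \<epsilon> :: "'p \<Rightarrow> 'n"
  assumes adjunction: "adjunction C D F G \<eta> \<epsilon>"
begin

sublocale F: functor_between C D F
  by unfold_locales (use adjunction in \<open>simp add: adjunction_def\<close>)

sublocale G: functor_between D C G
  by unfold_locales (use adjunction in \<open>simp add: adjunction_def\<close>)

lemma unit [simp]:
  assumes "x \<in> Obj C"
  shows "\<eta> x \<in> Arr C" "Dom C (\<eta> x) = x" "Cod C (\<eta> x) = FObj G (FObj F x)"
  using adjunction assms
  by (auto simp: adjunction_def nat_trans_def Hom_def id_functor_def comp_functor_def)

lemma counit [simp]:
  assumes "y \<in> Obj D"
  shows "\<epsilon> y \<in> Arr D" "Dom D (\<epsilon> y) = FObj F (FObj G y)" "Cod D (\<epsilon> y) = y"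
  using adjunction assms
  by (auto simp: adjunction_def nat_trans_def Hom_def id_functor_def comp_functor_def)

lemma unit_nat:
  "f \<in> Arr C \<Longrightarrow> \<eta> (Cod C f) \<cdot>\<^bsub>C\<^esub> f = FArr G (FArr F f) \<cdot>\<^bsub>C\<^esub> \<eta> (Dom C f)"
  using adjunction by (auto simp: adjunction_def nat_trans_def id_functor_def comp_functor_def)

lemma counit_nat:
  "g \<in> Arr D \<Longrightarrow> \<epsilon> (Cod D g) \<cdot>\<^bsub>D\<^esub> FArr F (FArr G g) = g \<cdot>\<^bsub>D\<^esub> \<epsilon> (Dom D g)"
  using adjunction by (auto simp: adjunction_def nat_trans_def id_functor_def comp_functor_def)

lemma triangle_left: "x \<in> Obj C \<Longrightarrow> \<epsilon> (FObj F x) \<cdot>\<^bsub>D\<^esub> FArr F (\<eta> x) = Ide D (FObj F x)"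
  and triangle_right: "y \<in> Obj D \<Longrightarrow> FArr G (\<epsilon> y) \<cdot>\<^bsub>C\<^esub> \<eta> (FObj G y) = Ide C (FObj G y)"
  using adjunction by (auto simp: adjunction_def)

lemma ex1_transpose:
  assumes x: "x \<in> Obj C" and y: "y \<in> Obj D" and g: "g \<in> Hom D (FObj F x) y"
  shows "\<exists>!h. h \<in> Hom C x (FObj G y) \<and> \<epsilon> y \<cdot>\<^bsub>D\<^esub> FArr F h = g"
proof (rule ex1I)
  let ?h = "FArr G g \<cdot>\<^bsub>C\<^esub> \<eta> x"
  have "\<epsilon> y \<cdot>\<^bsub>D\<^esub> FArr F ?h = (\<epsilon> y \<cdot>\<^bsub>D\<^esub> FArr F (FArr G g)) \<cdot>\<^bsub>D\<^esub> FArr F (\<eta> x)"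
    using x y g by (simp add: Hom_def)
  also have "\<dots> = g \<cdot>\<^bsub>D\<^esub> \<epsilon> (FObj F x) \<cdot>\<^bsub>D\<^esub> FArr F (\<eta> x)"
    using counit_nat[of g] x y g by (auto simp: Hom_def)
  also have "\<dots> = g"
    using triangle_left[OF x] x y g by (simp add: Hom_def)
  finally show "?h \<in> Hom C x (FObj G y) \<and> \<epsilon> y \<cdot>\<^bsub>D\<^esub> FArr F ?h = g"
    using x y g by (simp add: Hom_def)
next
  fix h assume "h \<in> Hom C x (FObj G y) \<and> \<epsilon> y \<cdot>\<^bsub>D\<^esub> FArr F h = g"
  then have h: "h \<in> Arr C" "Dom C h = x" "Cod C h = FObj G y" and eq: "g = \<epsilon> y \<cdot>\<^bsub>D\<^esub> FArr F h"
    by (auto simp: Hom_def)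
  have "FArr G g \<cdot>\<^bsub>C\<^esub> \<eta> x = FArr G (\<epsilon> y) \<cdot>\<^bsub>C\<^esub> FArr G (FArr F h) \<cdot>\<^bsub>C\<^esub> \<eta> x"
    unfolding eq using h x y by simp
  also have "FArr G (FArr F h) \<cdot>\<^bsub>C\<^esub> \<eta> x = \<eta> (FObj G y) \<cdot>\<^bsub>C\<^esub> h"
    using unit_nat[OF h(1)] h by simp
  also have "FArr G (\<epsilon> y) \<cdot>\<^bsub>C\<^esub> \<eta> (FObj G y) \<cdot>\<^bsub>C\<^esub> h = (FArr G (\<epsilon> y) \<cdot>\<^bsub>C\<^esub> \<eta> (FObj G y)) \<cdot>\<^bsub>C\<^esub> h"
    using h y by simp
  also have "\<dots> = h" using triangle_right[OF y] h by simp
  finally show "h = FArr G g \<cdot>\<^bsub>C\<^esub> \<eta> x" by simp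
qed

abbreviation alg :: "'o \<times> 'm \<Rightarrow> bool" where
  "alg \<equiv> is_algebra C (comp_functor G F) \<eta> (\<lambda>x. FArr G (\<epsilon> (FObj F x)))"

lemma alg_iff:
  "alg (x, a) \<longleftrightarrow> x \<in> Obj C \<and> a \<in> Arr C \<and> Dom C a = FObj G (FObj F x) \<and> Cod C a = x \<and>
     a \<cdot>\<^bsub>C\<^esub> \<eta> x = Ide C x \<and>
     a \<cdot>\<^bsub>C\<^esub> FArr G (\<epsilon> (FObj F x)) = a \<cdot>\<^bsub>C\<^esub> FArr G (FArr F a)"
  by (auto simp: is_algebra_def Hom_def comp_functor_def)

lemma alg_comparison: "y \<in> Obj D \<Longrightarrow> alg (FObj G y, FArr G (\<epsilon> y))"
  using counit_nat[of "\<epsilon> y"] G.FArr_Comp[of "FArr F (FArr G (\<epsilon> y))" "\<epsilon> y"]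
    G.FArr_Comp[of "\<epsilon> (FObj F (FObj G y))" "\<epsilon> y"]
  by (simp add: alg_iff triangle_right del: G.FArr_Comp)

definition alg_hom :: "'o \<times> 'm \<Rightarrow> 'o \<times> 'm \<Rightarrow> 'm set" where
  "alg_hom X Y = {h \<in> Hom C (fst X) (fst Y).
     h \<cdot>\<^bsub>C\<^esub> snd X = snd Y \<cdot>\<^bsub>C\<^esub> FArr G (FArr F h)}"

lemma Hom_EM_adj:
  assumes "alg X" "alg Y"
  shows "Hom (EM_adj C F G \<eta> \<epsilon>) X Y = (\<lambda>h. (X, h, Y)) ` alg_hom X Y"
  using assms
  by (cases X; cases Y) (auto simp: Hom_def EM_adj_def EM_def alg_hom_def comp_functor_def)

text \<open>An invertible algebra homomorphism is an isomorphism of algebras because the underlying inverse is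
again a homomorphism, so isomorphism of algebras needs to be checked in \<open>C\<close> only.\<close>

lemma isomorphic_obj_EM_adj_iff:
  assumes X: "alg X" and Y: "alg Y"
  shows "isomorphic_obj (EM_adj C F G \<eta> \<epsilon>) X Y \<longleftrightarrow> (\<exists>h \<in> alg_hom X Y. iso_arr C h)"
proof
  assume "isomorphic_obj (EM_adj C F G \<eta> \<epsilon>) X Y"
  then obtain f where f: "f \<in> Hom (EM_adj C F G \<eta> \<epsilon>) X Y" "iso_arr (EM_adj C F G \<eta> \<epsilon>) f"
    by (auto simp: isomorphic_obj_def)
  obtain h where h: "h \<in> alg_hom X Y" "f = (X, h, Y)"
    using f(1) Hom_EM_adj[OF X Y] by auto
  have "\<exists>g \<in> Hom (EM_adj C F G \<eta> \<epsilon>) Y X.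
      g \<cdot>\<^bsub>EM_adj C F G \<eta> \<epsilon>\<^esub> f = Ide (EM_adj C F G \<eta> \<epsilon>) X \<and>
      f \<cdot>\<^bsub>EM_adj C F G \<eta> \<epsilon>\<^esub> g = Ide (EM_adj C F G \<eta> \<epsilon>) Y"
    using f by (auto simp: iso_arr_def Hom_def)
  then obtain i where i: "i \<in> alg_hom Y X" "i \<cdot>\<^bsub>C\<^esub> h = Ide C (fst X)" "h \<cdot>\<^bsub>C\<^esub> i = Ide C (fst Y)"
    using Hom_EM_adj[OF Y X] by (auto simp: h EM_adj_def EM_def)
  have "iso_arr C h"
    by (rule F.Src.iso_arrI[OF _ _ i(2,3)]) (use h i in \<open>auto simp: alg_hom_def\<close>)
  then show "\<exists>h \<in> alg_hom X Y. iso_arr C h" using h by blast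
next
  assume "\<exists>h \<in> alg_hom X Y. iso_arr C h"
  then obtain h where h': "h \<in> alg_hom X Y" and iso: "iso_arr C h" by blast
  obtain x a y b where XY: "X = (x, a)" "Y = (y, b)" by (metis surj_pair)
  have h: "h \<in> Arr C" "Dom C h = x" "Cod C h = y"
    "h \<cdot>\<^bsub>C\<^esub> a = b \<cdot>\<^bsub>C\<^esub> FArr G (FArr F h)"
    using h' by (auto simp: alg_hom_def Hom_def XY)
  obtain i where i: "i \<in> Arr C" "Dom C i = y" "Cod C i = x"
    "i \<cdot>\<^bsub>C\<^esub> h = Ide C x" "h \<cdot>\<^bsub>C\<^esub> i = Ide C y"
    using iso F.Src.iso_arrE h by metis
  have a: "a \<in> Arr C" "Dom C a = FObj G (FObj F x)" "Cod C a = x" "x \<in> Obj C"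
    and b: "b \<in> Arr C" "Dom C b = FObj G (FObj F y)" "Cod C b = y" "y \<in> Obj C"
    using X Y by (auto simp: XY alg_iff)
  have "i \<cdot>\<^bsub>C\<^esub> b = a \<cdot>\<^bsub>C\<^esub> FArr G (FArr F i)"
  proof (rule F.Src.iso_arr_cancel_right)
    show "iso_arr C (FArr G (FArr F h))"
      using iso by (intro G.iso_arr_FArr F.iso_arr_FArr)
    have "(i \<cdot>\<^bsub>C\<^esub> b) \<cdot>\<^bsub>C\<^esub> FArr G (FArr F h) = (i \<cdot>\<^bsub>C\<^esub> h) \<cdot>\<^bsub>C\<^esub> a"
      using h a b i(1-3) by simp
    also have "\<dots> = a \<cdot>\<^bsub>C\<^esub> FArr G (FArr F (i \<cdot>\<^bsub>C\<^esub> h))"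
      unfolding i(4) using a by simp
    also have "\<dots> = (a \<cdot>\<^bsub>C\<^esub> FArr G (FArr F i)) \<cdot>\<^bsub>C\<^esub> FArr G (FArr F h)"
      using h(1-3) a i(1-3) by simp
    finally show "(i \<cdot>\<^bsub>C\<^esub> b) \<cdot>\<^bsub>C\<^esub> FArr G (FArr F h) =
        (a \<cdot>\<^bsub>C\<^esub> FArr G (FArr F i)) \<cdot>\<^bsub>C\<^esub> FArr G (FArr F h)" .
  qed (use h(1-3) i(1-3) a b in simp_all)
  then have i': "i \<in> alg_hom Y X" using i by (simp add: alg_hom_def Hom_def XY)
  have hom: "(X, h, Y) \<in> Hom (EM_adj C F G \<eta> \<epsilon>) X Y" "(Y, i, X) \<in> Hom (EM_adj C F G \<eta> \<epsilon>) Y X"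
    using h' i' Hom_EM_adj[OF X Y] Hom_EM_adj[OF Y X] by auto
  have "iso_arr (EM_adj C F G \<eta> \<epsilon>) (X, h, Y)"
    unfolding iso_arr_def using hom i(4,5)
    by (auto simp: Hom_def EM_adj_def EM_def XY intro!: bexI[of _ "(Y, i, X)"])
  then show "isomorphic_obj (EM_adj C F G \<eta> \<epsilon>) X Y"
    unfolding isomorphic_obj_def using hom(1) by blast
qed

abbreviation comparison_alg :: "'p \<Rightarrow> 'o \<times> 'm" where
  "comparison_alg y \<equiv> (FObj G y, FArr G (\<epsilon> y))"

lemma fully_faithful_comparison_iff:
  "fully_faithful D (EM_adj C F G \<eta> \<epsilon>) (comparison D G \<epsilon>) \<longleftrightarrow>
     (\<forall>y \<in> Obj D. \<forall>y' \<in> Obj D. bij_betw (FArr G) (Hom D y y') (alg_hom (comparison_alg y) (comparison_alg y')))"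
proof -
  have "bij_betw (FArr (comparison D G \<epsilon>)) (Hom D y y')
      (Hom (EM_adj C F G \<eta> \<epsilon>) (FObj (comparison D G \<epsilon>) y) (FObj (comparison D G \<epsilon>) y')) \<longleftrightarrow>
      bij_betw (FArr G) (Hom D y y') (alg_hom (comparison_alg y) (comparison_alg y'))" (is "?l \<longleftrightarrow> ?r")
    if y: "y \<in> Obj D" "y' \<in> Obj D" for y y'
  proof -
    let ?i = "\<lambda>h. (comparison_alg y, h, comparison_alg y')"
    have "?l \<longleftrightarrow> bij_betw (?i \<circ> FArr G) (Hom D y y') (?i ` alg_hom (comparison_alg y) (comparison_alg y'))"
      unfolding Hom_EM_adj[OF alg_comparison[OF y(1)] alg_comparison[OF y(2)], symmetric]
      by (auto simp: comparison_def Hom_def intro!: bij_betw_cong)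
    also have "\<dots> \<longleftrightarrow> ?r"
    proof -
      have "(?i \<circ> FArr G) ` S = ?i ` T \<longleftrightarrow> FArr G ` S = T" for S T
        unfolding image_comp[symmetric] by (rule inj_image_eq_iff) (simp add: inj_on_def)
      then show ?thesis by (simp add: bij_betw_def inj_on_def)
    qed
    finally show ?thesis .
  qed
  then show ?thesis by (simp add: fully_faithful_def)
qed

lemma essentially_surjective_comparison_iff:
  "essentially_surjective D (EM_adj C F G \<eta> \<epsilon>) (comparison D G \<epsilon>) \<longleftrightarrow>
     (\<forall>X. alg X \<longrightarrow> (\<exists>y \<in> Obj D. \<exists>h \<in> alg_hom (comparison_alg y) X. iso_arr C h))"
proof -
  have "Obj (EM_adj C F G \<eta> \<epsilon>) = {X. alg X}" by (simp add: EM_adj_def EM_def)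
  moreover have "FObj (comparison D G \<epsilon>) y = comparison_alg y" for y by (simp add: comparison_def)
  ultimately show ?thesis
    using isomorphic_obj_EM_adj_iff[OF alg_comparison]
    unfolding essentially_surjective_def by (simp cong: bex_cong)
qed

text \<open>Monadicity without mention of the Eilenberg-Moore category: \<open>G\<close> identifies the arrows \<open>y \<rightarrow> y'\<close>
with the homomorphisms between the algebras \<open>G \<epsilon>\<^sub>y\<close> and \<open>G \<epsilon>\<^sub>y\<^sub>'\<close>, and every algebra is isomorphic
to one of this form. In the situation of effective descent, algebras are descent data, and the
second condition says that every descent datum is effective.\<close>

theorem monadic_iff:
  "monadic_adjunction C D F G \<eta> \<epsilon> \<longleftrightarrow>
     (\<forall>y \<in> Obj D. \<forall>y' \<in> Obj D. bij_betw (FArr G) (Hom D y y') (alg_hom (comparison_alg y) (comparison_alg y'))) \<and>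
     (\<forall>X. alg X \<longrightarrow> (\<exists>y \<in> Obj D. \<exists>h \<in> alg_hom (comparison_alg y) X. iso_arr C h))"
  unfolding monadic_adjunction_def fully_faithful_comparison_iff[symmetric]
    essentially_surjective_comparison_iff[symmetric]
  using adjunction is_functor_comparison[OF adjunction] equivalence_imp_fully_faithful
    equivalence_imp_essentially_surjective fully_faithful_essentially_surjective_imp_equivalence
  by blast

end

section \<open>Coreflections\<close>

text \<open>A full coreflective subcategory, given by an embedding \<open>L : C' \<rightarrow> C\<close> with right adjoint \<open>U\<close> and
counit \<open>c\<close>. The unit is required to be an identity, \<open>U L = 1\<close>; this holds in the scone and is
inherited by slices, and it keeps coherence isomorphisms out of the arguments below. An object \<open>u\<close>
lies in the subcategory, up to isomorphism, exactly when \<open>c u\<close> is invertible; such objects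
are called coreflected.\<close>

locale coreflection =
  L: functor_between C' C L + U: functor_between C C' U
  for C :: "('o, 'm) cat" and C' :: "('p, 'n) cat"
    and L :: "('p, 'n, 'o, 'm) functr" and U :: "('o, 'm, 'p, 'n) functr" +
  fixes c :: "'o \<Rightarrow> 'm"
  assumes U_L_Obj [simp]: "w \<in> Obj C' \<Longrightarrow> FObj U (FObj L w) = w"
    and U_L_Arr [simp]: "h \<in> Arr C' \<Longrightarrow> FArr U (FArr L h) = h"
    and counit: "u \<in> Obj C \<Longrightarrow> c u \<in> Hom C (FObj L (FObj U u)) u"
    and counit_nat: "f \<in> Arr C \<Longrightarrow> f \<cdot>\<^bsub>C\<^esub> c (Dom C f) = c (Cod C f) \<cdot>\<^bsub>C\<^esub> FArr L (FArr U f)"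
    and U_counit [simp]: "u \<in> Obj C \<Longrightarrow> FArr U (c u) = Ide C' (FObj U u)"
    and counit_L [simp]: "w \<in> Obj C' \<Longrightarrow> c (FObj L w) = Ide C (FObj L w)"
begin

lemma counit_Arr [simp]:
  "u \<in> Obj C \<Longrightarrow> c u \<in> Arr C"
  "u \<in> Obj C \<Longrightarrow> Dom C (c u) = FObj L (FObj U u)"
  "u \<in> Obj C \<Longrightarrow> Cod C (c u) = u"
  using counit[of u] by (auto simp: Hom_def)

text \<open>Together with the next lemma: out of a coreflected object, arrows of \<open>C\<close> are the same as arrows of
\<open>C'\<close> between the images under \<open>U\<close>. All equations between arrows with coreflected source can
therefore be checked after applying \<open>U\<close>, and the inverse of \<open>c\<close> never has to be written down.\<close>

lemma eq_if_U_eq: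
  assumes "iso_arr C (c (Dom C f))" "f \<in> Arr C" "g \<in> Arr C" "Dom C f = Dom C g" "Cod C f = Cod C g"
    and "FArr U f = FArr U g"
  shows "f = g"
  by (rule L.Tgt.iso_arr_cancel_right[OF assms(1)]) (use assms counit_nat[of f] counit_nat[of g] in simp_all)

lemma U_lift:
  assumes iso: "iso_arr C (c u)" and u: "u \<in> Obj C" and v: "v \<in> Obj C"
    and h: "h \<in> Hom C' (FObj U u) (FObj U v)"
  obtains r where "r \<in> Arr C" "Dom C r = u" "Cod C r = v" "FArr U r = h"
proof -
  obtain i where i: "i \<in> Arr C" "Dom C i = u" "Cod C i = FObj L (FObj U u)"
    "c u \<cdot>\<^bsub>C\<^esub> i = Ide C u"
    using iso L.Tgt.iso_arrE u by (metis counit_Arr)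
  have "FArr U (c u \<cdot>\<^bsub>C\<^esub> i) = Ide C' (FObj U u)" unfolding i(4) using u by simp
  then have "FArr U i = Ide C' (FObj U u)" using u i(1-3) by simp
  then have "FArr U (c v \<cdot>\<^bsub>C\<^esub> FArr L h \<cdot>\<^bsub>C\<^esub> i) = h"
    using u v h i(1-3) by (simp add: Hom_def)
  then show thesis
    by (rule that[rotated -1]) (use u v h i(1-3) in \<open>simp_all add: Hom_def\<close>)
qed

end

section \<open>Restricting a monadic adjunction to coreflective subcategories\<close>

text \<open>Two coreflective subcategories, of the source and of the target of a left adjoint \<open>F\<close>, such that
\<open>F\<close> commutes with the embeddings, the coreflectors and the counits, and thus restricts to
\<open>F' : C' \<rightarrow> D'\<close>. The last two assumptions express strictness: an object that admits an arrow to an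
object of the subcategory of \<open>D\<close> is itself coreflected, and so is an object of \<open>C\<close> whose image
under \<open>F\<close> admits such an arrow. In the application \<open>F\<close> is composition with an arrow \<open>p\<close>, between
slice categories.\<close>

locale coreflected_adjunction =
  A: adjoint_functors C D F G \<eta> \<epsilon> +
  C: coreflection C C' LC UC cC +
  D: coreflection D D' LD UD cD +
  F': functor_between C' D' F'
  for C :: "('o, 'm) cat" and D :: "('p, 'n) cat"
    and F :: "('o, 'm, 'p, 'n) functr" and G :: "('p, 'n, 'o, 'm) functr"
    and \<eta> :: "'o \<Rightarrow> 'm" and \<epsilon> :: "'p \<Rightarrow> 'n"
    and C' :: "('o1, 'm1) cat" and D' :: "('p1, 'n1) cat"
    and F' :: "('o1, 'm1, 'p1, 'n1) functr"
    and LC :: "('o1, 'm1, 'o, 'm) functr" and UC :: "('o, 'm, 'o1, 'm1) functr"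
    and LD :: "('p1, 'n1, 'p, 'n) functr" and UD :: "('p, 'n, 'p1, 'n1) functr"
    and cC :: "'o \<Rightarrow> 'm" and cD :: "'p \<Rightarrow> 'n" +
  assumes F_L_Obj [simp]: "w \<in> Obj C' \<Longrightarrow> FObj F (FObj LC w) = FObj LD (FObj F' w)"
    and F_L_Arr [simp]: "h \<in> Arr C' \<Longrightarrow> FArr F (FArr LC h) = FArr LD (FArr F' h)"
    and U_F_Obj [simp]: "u \<in> Obj C \<Longrightarrow> FObj UD (FObj F u) = FObj F' (FObj UC u)"
    and U_F_Arr [simp]: "f \<in> Arr C \<Longrightarrow> FArr UD (FArr F f) = FArr F' (FArr UC f)"
    and F_counit [simp]: "u \<in> Obj C \<Longrightarrow> FArr F (cC u) = cD (FObj F u)"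
    and strict_C: "\<lbrakk>u \<in> Obj C; z \<in> Obj D'; g \<in> Arr D; Dom D g = FObj F u; Cod D g = FObj LD z\<rbrakk>
      \<Longrightarrow> iso_arr C (cC u)"
    and strict_D: "\<lbrakk>z \<in> Obj D'; g \<in> Arr D; Cod D g = FObj LD z\<rbrakk> \<Longrightarrow> iso_arr D (cD (Dom D g))"
begin

text \<open>The right adjoint of \<open>F'\<close> is \<open>U G L\<close>: arrows \<open>F' w \<rightarrow> z\<close> are arrows \<open>F (L w) = L (F' w) \<rightarrow> L z\<close>, hence
arrows \<open>L w \<rightarrow> G (L z)\<close>, hence arrows \<open>w \<rightarrow> U (G (L z))\<close>.\<close>

definition G' :: "('p1, 'n1, 'o1, 'm1) functr" where
  "G' = comp_functor UC (comp_functor G LD)"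

definition \<eta>' :: "'o1 \<Rightarrow> 'm1" where
  "\<eta>' w = FArr UC (\<eta> (FObj LC w))"

definition \<epsilon>' :: "'p1 \<Rightarrow> 'n1" where
  "\<epsilon>' z = FArr UD (\<epsilon> (FObj LD z))"

lemma G'_Obj [simp]: "FObj G' z = FObj UC (FObj G (FObj LD z))"
  and G'_Arr [simp]: "FArr G' k = FArr UC (FArr G (FArr LD k))"
  by (simp_all add: G'_def comp_functor_def)

lemma L_U_counit:
  "z \<in> Obj D' \<Longrightarrow>
    FArr LD (\<epsilon>' z) = \<epsilon> (FObj LD z) \<cdot>\<^bsub>D\<^esub> cD (FObj F (FObj G (FObj LD z)))"
  using D.counit_nat[of "\<epsilon> (FObj LD z)"] by (simp add: \<epsilon>'_def)

lemma adjunction': "adjunction C' D' F' G' \<eta>' \<epsilon>'"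
proof -
  have G': "is_functor D' C' G'"
    by (auto simp: is_functor_def Hom_def C.L.Src.category_axioms D.L.Src.category_axioms)
  have ids: "is_functor C' C' id_functor" "is_functor D' D' id_functor"
    "is_functor C' C' (comp_functor G' F')" "is_functor D' D' (comp_functor F' G')"
    by (auto simp: is_functor_def Hom_def comp_functor_def id_functor_def
        C.L.Src.category_axioms D.L.Src.category_axioms)
  have e: "\<epsilon>' z \<in> Hom D' (FObj F' (FObj G' z)) z" if "z \<in> Obj D'" for z
    using that by (simp add: \<epsilon>'_def Hom_def)
  have n: "\<eta>' w \<in> Hom C' w (FObj G' (FObj F' w))" if "w \<in> Obj C'" for w
    using that by (simp add: \<eta>'_def Hom_def)
  have e_nat: "\<epsilon>' (Cod D' k) \<cdot>\<^bsub>D'\<^esub> FArr F' (FArr G' k) = k \<cdot>\<^bsub>D'\<^esub> \<epsilon>' (Dom D' k)"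
    if k: "k \<in> Arr D'" for k
    using arg_cong[OF A.counit_nat[of "FArr LD k"], of "FArr UD"] k by (simp add: \<epsilon>'_def)
  have n_nat: "\<eta>' (Cod C' h) \<cdot>\<^bsub>C'\<^esub> h = FArr G' (FArr F' h) \<cdot>\<^bsub>C'\<^esub> \<eta>' (Dom C' h)"
    if h: "h \<in> Arr C'" for h
    using arg_cong[OF A.unit_nat[of "FArr LC h"], of "FArr UC"] h by (simp add: \<eta>'_def)
  have t1: "\<epsilon>' (FObj F' w) \<cdot>\<^bsub>D'\<^esub> FArr F' (\<eta>' w) = Ide D' (FObj F' w)" if w: "w \<in> Obj C'" for w
    using arg_cong[OF A.triangle_left[of "FObj LC w"], of "FArr UD"] w by (simp add: \<epsilon>'_def \<eta>'_def)
  have t2: "FArr G' (\<epsilon>' z) \<cdot>\<^bsub>C'\<^esub> \<eta>' (FObj G' z) = Ide C' (FObj G' z)" if z: "z \<in> Obj D'" for z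
  proof -
    let ?u = "FObj G (FObj LD z)"
    \<comment> \<open>Moving \<open>c\<close> past \<open>\<eta>\<close> by naturality puts it next to \<open>U\<close>, which turns it into an identity; what
      remains is the image under \<open>U\<close> of a triangle identity for \<open>F\<close> and \<open>G\<close>.\<close>
    have "FArr G' (\<epsilon>' z) \<cdot>\<^bsub>C'\<^esub> \<eta>' (FObj G' z) =
        FArr UC (FArr G (\<epsilon> (FObj LD z)) \<cdot>\<^bsub>C\<^esub> FArr G (FArr F (cC ?u)) \<cdot>\<^bsub>C\<^esub> \<eta> (FObj LC (FObj UC ?u)))"
      using z by (simp add: L_U_counit \<eta>'_def)
    also have "FArr G (FArr F (cC ?u)) \<cdot>\<^bsub>C\<^esub> \<eta> (FObj LC (FObj UC ?u)) = \<eta> ?u \<cdot>\<^bsub>C\<^esub> cC ?u"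
      using A.unit_nat[of "cC ?u"] z by simp
    also have "FArr UC (FArr G (\<epsilon> (FObj LD z)) \<cdot>\<^bsub>C\<^esub> \<eta> ?u \<cdot>\<^bsub>C\<^esub> cC ?u) =
        FArr UC (FArr G (\<epsilon> (FObj LD z)) \<cdot>\<^bsub>C\<^esub> \<eta> ?u)"
      using z by simp
    also have "\<dots> = Ide C' (FObj G' z)"
      unfolding A.triangle_right[OF D.L.FObj_closed[OF z]] using z by simp
    finally show ?thesis .
  qed
  show ?thesis
    unfolding adjunction_def nat_trans_def
    using G' ids e n e_nat n_nat t1 t2 F'.is_functor
    by (auto simp: id_functor_def comp_functor_def)
qed

sublocale A': adjoint_functors C' D' F' G' \<eta>' \<epsilon>'
  by unfold_locales (rule adjunction')

lemma counit_iso_G_L: "z \<in> Obj D' \<Longrightarrow> iso_arr C (cC (FObj G (FObj LD z)))"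
  by (rule strict_C[of _ z "\<epsilon> (FObj LD z)"]) simp_all

lemma counit_iso_G:
  assumes v: "v \<in> Obj D" and f: "f \<in> Arr D" "Dom D f = v" "Cod D f = FObj LD z" "z \<in> Obj D'"
  shows "iso_arr C (cC (FObj G v))"
  by (rule strict_C[of _ z "f \<cdot>\<^bsub>D\<^esub> \<epsilon> v"]) (use assms in simp_all)

text \<open>The algebra that the restricted comparison functor assigns to \<open>z\<close> is the image under \<open>U\<close> of the
algebra on \<open>G (L z)\<close>, up to a factor that is invertible, by the next lemma, as soon as \<open>G (L z)\<close>
is coreflected. This is how homomorphism conditions pass between \<open>C'\<close> and \<open>C\<close>.\<close>

lemma G'_counit:
  "z \<in> Obj D' \<Longrightarrow> FArr G' (\<epsilon>' z) =
    FArr UC (FArr G (\<epsilon> (FObj LD z))) \<cdot>\<^bsub>C'\<^esub> FArr UC (FArr G (cD (FObj F (FObj G (FObj LD z)))))"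
  by (simp add: L_U_counit)

lemma iso_U_T_counit:
  assumes "u \<in> Obj C" "iso_arr C (cC u)"
  shows "iso_arr C' (FArr UC (FArr G (cD (FObj F u))))"
  using C.U.iso_arr_FArr[OF A.G.iso_arr_FArr[OF A.F.iso_arr_FArr[OF assms(2)]]] assms(1) by simp

lemma comparison_faithful:
  assumes ff: "\<forall>y \<in> Obj D. \<forall>y' \<in> Obj D.
      bij_betw (FArr G) (Hom D y y') (A.alg_hom (A.comparison_alg y) (A.comparison_alg y'))"
    and z: "z \<in> Obj D'" and z': "z' \<in> Obj D'"
  shows "inj_on (FArr G') (Hom D' z z')"
proof (rule inj_onI)
  fix k l assume k: "k \<in> Hom D' z z'" and l: "l \<in> Hom D' z z'" and eq: "FArr G' k = FArr G' l"
  have "FArr G (FArr LD k) = FArr G (FArr LD l)"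
    by (rule C.eq_if_U_eq) (use k l eq z counit_iso_G_L[OF z] in \<open>simp_all add: Hom_def\<close>)
  moreover have "inj_on (FArr G) (Hom D (FObj LD z) (FObj LD z'))"
    using ff z z' by (auto simp: bij_betw_def)
  ultimately have "FArr LD k = FArr LD l"
    using k l by (auto simp: inj_on_def Hom_def)
  then have "FArr UD (FArr LD k) = FArr UD (FArr LD l)" by simp
  then show "k = l" using k l by (simp add: Hom_def)
qed

text \<open>A homomorphism between the algebras of \<open>z\<close> and \<open>z'\<close> lifts along \<open>U\<close> to an arrow
\<open>G (L z) \<rightarrow> G (L z')\<close>, since \<open>G (L z)\<close> is coreflected. The lift is again a homomorphism because that
can be tested after applying \<open>U\<close>, so it comes from an arrow \<open>L z \<rightarrow> L z'\<close>, to which \<open>U\<close> is applied.\<close>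

lemma comparison_full:
  assumes ff: "\<forall>y \<in> Obj D. \<forall>y' \<in> Obj D.
      bij_betw (FArr G) (Hom D y y') (A.alg_hom (A.comparison_alg y) (A.comparison_alg y'))"
    and z: "z \<in> Obj D'" and z': "z' \<in> Obj D'"
    and h': "h' \<in> A'.alg_hom (A'.comparison_alg z) (A'.comparison_alg z')"
  shows "\<exists>k \<in> Hom D' z z'. FArr G' k = h'"
proof -
  let ?u = "FObj G (FObj LD z)" and ?u' = "FObj G (FObj LD z')"
  have h'1: "h' \<in> Arr C'" "Dom C' h' = FObj UC ?u" "Cod C' h' = FObj UC ?u'"
    and h'2: "h' \<cdot>\<^bsub>C'\<^esub> FArr G' (\<epsilon>' z) = FArr G' (\<epsilon>' z') \<cdot>\<^bsub>C'\<^esub> FArr G' (FArr F' h')"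
    using h' by (auto simp: A'.alg_hom_def Hom_def)
  obtain h where h: "h \<in> Arr C" "Dom C h = ?u" "Cod C h = ?u'" "FArr UC h = h'"
    by (rule C.U_lift[of ?u ?u' h']) (use counit_iso_G_L z z' h'1 in \<open>simp_all add: Hom_def\<close>)
  have Lh: "cC ?u' \<cdot>\<^bsub>C\<^esub> FArr LC h' = h \<cdot>\<^bsub>C\<^esub> cC ?u"
    using C.counit_nat[OF h(1)] h by simp
  have FLh: "cD (FObj F ?u') \<cdot>\<^bsub>D\<^esub> FArr LD (FArr F' h') = FArr F h \<cdot>\<^bsub>D\<^esub> cD (FObj F ?u)"
    using arg_cong[OF Lh, of "FArr F"] h(1-3) h'1 z z' by simp
  have "FArr UC (h \<cdot>\<^bsub>C\<^esub> FArr G (\<epsilon> (FObj LD z))) =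
      FArr UC (FArr G (\<epsilon> (FObj LD z')) \<cdot>\<^bsub>C\<^esub> FArr G (FArr F h))"
  proof (rule C.L.Src.iso_arr_cancel_right)
    show "iso_arr C' (FArr UC (FArr G (cD (FObj F ?u))))"
      using iso_U_T_counit counit_iso_G_L z by simp
    have "FArr UC (h \<cdot>\<^bsub>C\<^esub> FArr G (\<epsilon> (FObj LD z))) \<cdot>\<^bsub>C'\<^esub> FArr UC (FArr G (cD (FObj F ?u))) =
        h' \<cdot>\<^bsub>C'\<^esub> FArr G' (\<epsilon>' z)"
      unfolding G'_counit[OF z] using h h'1 z by simp
    also have "\<dots> = FArr UC (FArr G (\<epsilon> (FObj LD z')) \<cdot>\<^bsub>C\<^esub>
        FArr G (cD (FObj F ?u') \<cdot>\<^bsub>D\<^esub> FArr LD (FArr F' h')))"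
      unfolding h'2 G'_counit[OF z'] using h'1 z z' by simp
    also have "\<dots> = FArr UC (FArr G (\<epsilon> (FObj LD z')) \<cdot>\<^bsub>C\<^esub> FArr G (FArr F h)) \<cdot>\<^bsub>C'\<^esub>
        FArr UC (FArr G (cD (FObj F ?u)))"
      unfolding FLh using h(1-3) z z' by simp
    finally show "FArr UC (h \<cdot>\<^bsub>C\<^esub> FArr G (\<epsilon> (FObj LD z))) \<cdot>\<^bsub>C'\<^esub>
        FArr UC (FArr G (cD (FObj F ?u))) =
        FArr UC (FArr G (\<epsilon> (FObj LD z')) \<cdot>\<^bsub>C\<^esub> FArr G (FArr F h)) \<cdot>\<^bsub>C'\<^esub>
        FArr UC (FArr G (cD (FObj F ?u)))" .
  qed (use h(1-3) z z' in simp_all)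
  moreover have "iso_arr C (cC (FObj G (FObj F ?u)))"
    by (rule counit_iso_G[of _ "\<epsilon> (FObj LD z)" z]) (use z in simp_all)
  ultimately have "h \<cdot>\<^bsub>C\<^esub> FArr G (\<epsilon> (FObj LD z)) = FArr G (\<epsilon> (FObj LD z')) \<cdot>\<^bsub>C\<^esub> FArr G (FArr F h)"
    by (intro C.eq_if_U_eq) (use h(1-3) z z' in simp_all)
  then have "h \<in> A.alg_hom (A.comparison_alg (FObj LD z)) (A.comparison_alg (FObj LD z'))"
    using h by (simp add: A.alg_hom_def Hom_def)
  moreover have "bij_betw (FArr G) (Hom D (FObj LD z) (FObj LD z'))
      (A.alg_hom (A.comparison_alg (FObj LD z)) (A.comparison_alg (FObj LD z')))"
    using ff z z' by simp
  ultimately obtain g where g: "g \<in> Hom D (FObj LD z) (FObj LD z')" "FArr G g = h"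
    unfolding bij_betw_def by (metis imageE)
  have "FArr LD (FArr UD g) = g"
    using D.counit_nat[of g] g z z' by (simp add: Hom_def)
  then have "FArr G' (FArr UD g) = h'" using g(2) h(4) by simp
  then show ?thesis using g(1) z z' by (intro bexI[of _ "FArr UD g"]) (simp_all add: Hom_def)
qed

text \<open>The heart of the argument: an object \<open>v\<close> of \<open>D\<close> is coreflected if \<open>G v\<close> maps to an object of the
subcategory. Here \<open>\<epsilon>\<^sub>v\<close> is the coequalizer of \<open>F G \<epsilon>\<^sub>v\<close> and \<open>\<epsilon>\<^sub>F\<^sub>G\<^sub>v\<close> by descent. The object \<open>F (G v)\<close>
is coreflected, hence \<open>\<epsilon>\<^sub>v\<close> factors through \<open>c v\<close> as an arrow \<open>e : F (G v) \<rightarrow> L (U v)\<close>, and \<open>e\<close>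
coequalizes the same pair. It therefore extends to an arrow \<open>v \<rightarrow> L (U v)\<close>, and by strictness the
mere existence of this arrow makes \<open>v\<close> coreflected. The universal property of the coequalizer is
used in the form of full faithfulness of the comparison functor, applied to the transpose \<open>t\<close>
of \<open>e\<close>.\<close>

lemma counit_iso_if_G_coreflected:
  assumes ff: "\<forall>y \<in> Obj D. \<forall>y' \<in> Obj D.
      bij_betw (FArr G) (Hom D y y') (A.alg_hom (A.comparison_alg y) (A.comparison_alg y'))"
    and v: "v \<in> Obj D" and w: "w \<in> Obj C'"
    and \<theta>: "\<theta> \<in> Arr C" "Dom C \<theta> = FObj G v" "Cod C \<theta> = FObj LC w"
  shows "iso_arr D (cD v)"
proof -
  let ?z = "FObj UD v" and ?u = "FObj G v"
  have z: "?z \<in> Obj D'" using v by simp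
  have iso1: "iso_arr D (cD (FObj F ?u))"
    using strict_D[of "FObj F' w" "FArr F \<theta>"] v w \<theta> by simp
  have iso2: "iso_arr D (cD (FObj F (FObj G (FObj F ?u))))"
    using strict_D[of "FObj F' w" "FArr F \<theta> \<cdot>\<^bsub>D\<^esub> \<epsilon> (FObj F ?u)"] v w \<theta> by simp
  obtain e where e: "e \<in> Arr D" "Dom D e = FObj F ?u" "Cod D e = FObj LD ?z"
    "FArr UD e = FArr UD (\<epsilon> v)"
    by (rule D.U_lift[OF iso1, of "FObj LD ?z" "FArr UD (\<epsilon> v)"]) (use v in \<open>simp_all add: Hom_def\<close>)
  \<comment> \<open>Both sides agree after applying \<open>U\<close>, where \<open>e\<close> becomes \<open>\<epsilon>\<^sub>v\<close>, by naturality of \<open>\<epsilon>\<close>.\<close>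
  have "e \<cdot>\<^bsub>D\<^esub> FArr F (FArr G (\<epsilon> v)) = e \<cdot>\<^bsub>D\<^esub> \<epsilon> (FObj F ?u)"
  proof (rule D.eq_if_U_eq)
    show "FArr UD (e \<cdot>\<^bsub>D\<^esub> FArr F (FArr G (\<epsilon> v))) = FArr UD (e \<cdot>\<^bsub>D\<^esub> \<epsilon> (FObj F ?u))"
      using arg_cong[OF A.counit_nat[of "\<epsilon> v"], of "FArr UD"] v e by simp
  qed (use v e iso2 in simp_all)
  then have coeq: "FArr G e \<cdot>\<^bsub>C\<^esub> FArr G (FArr F (FArr G (\<epsilon> v))) =
      FArr G e \<cdot>\<^bsub>C\<^esub> FArr G (\<epsilon> (FObj F ?u))"
    using v e A.G.FArr_Comp[of "FArr F (FArr G (\<epsilon> v))" e] A.G.FArr_Comp[of "\<epsilon> (FObj F ?u)" e]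
    by simp
  \<comment> \<open>Both composites in the homomorphism condition for \<open>t\<close> turn out to be \<open>G e\<close>.\<close>
  define t where "t = FArr G e \<cdot>\<^bsub>C\<^esub> \<eta> ?u"
  have t: "t \<in> Arr C" "Dom C t = ?u" "Cod C t = FObj G (FObj LD ?z)"
    using v e(1-3) by (simp_all add: t_def)
  have "t \<cdot>\<^bsub>C\<^esub> FArr G (\<epsilon> v) = FArr G e \<cdot>\<^bsub>C\<^esub> FArr G (FArr F (FArr G (\<epsilon> v))) \<cdot>\<^bsub>C\<^esub> \<eta> (FObj G (FObj F ?u))"
    using A.unit_nat[of "FArr G (\<epsilon> v)"] v e(1-3) by (simp add: t_def)
  also have "\<dots> = (FArr G e \<cdot>\<^bsub>C\<^esub> FArr G (FArr F (FArr G (\<epsilon> v)))) \<cdot>\<^bsub>C\<^esub> \<eta> (FObj G (FObj F ?u))"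
    using v e(1-3) by simp
  also have "\<dots> = FArr G e \<cdot>\<^bsub>C\<^esub> FArr G (\<epsilon> (FObj F ?u)) \<cdot>\<^bsub>C\<^esub> \<eta> (FObj G (FObj F ?u))"
    unfolding coeq using v e(1-3) by simp
  also have "\<dots> = FArr G e" using A.triangle_right[of "FObj F ?u"] v e(1-3) by simp
  finally have t1: "t \<cdot>\<^bsub>C\<^esub> FArr G (\<epsilon> v) = FArr G e" .
  have "\<epsilon> (FObj LD ?z) \<cdot>\<^bsub>D\<^esub> FArr F t =
      (\<epsilon> (FObj LD ?z) \<cdot>\<^bsub>D\<^esub> FArr F (FArr G e)) \<cdot>\<^bsub>D\<^esub> FArr F (\<eta> ?u)"
    using v e(1-3) by (simp add: t_def)
  also have "\<dots> = e \<cdot>\<^bsub>D\<^esub> \<epsilon> (FObj F ?u) \<cdot>\<^bsub>D\<^esub> FArr F (\<eta> ?u)"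
    using A.counit_nat[of e] v e(1-3) by simp
  also have "\<dots> = e" using A.triangle_left[of ?u] v e(1-3) by simp
  finally have "FArr G (\<epsilon> (FObj LD ?z)) \<cdot>\<^bsub>C\<^esub> FArr G (FArr F t) = FArr G e"
    using A.G.FArr_Comp[of "FArr F t" "\<epsilon> (FObj LD ?z)"] t z by simp
  then have "t \<in> A.alg_hom (A.comparison_alg v) (A.comparison_alg (FObj LD ?z))"
    using t t1 by (simp add: A.alg_hom_def Hom_def)
  moreover have "bij_betw (FArr G) (Hom D v (FObj LD ?z)) (A.alg_hom (A.comparison_alg v) (A.comparison_alg (FObj LD ?z)))"
    using ff v by simp
  ultimately obtain g where "g \<in> Hom D v (FObj LD ?z)"
    unfolding bij_betw_def by (metis imageE)
  then show ?thesis using strict_D[OF z, of g] by (simp add: Hom_def)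
qed

text \<open>An algebra on \<open>w\<close> lifts along \<open>U\<close> to an algebra on \<open>L w\<close>, because the objects \<open>T (L w)\<close> and
\<open>T (T (L w))\<close>, for \<open>T = G F\<close>, are coreflected. By monadicity of \<open>G\<close> the lifted algebra is isomorphic to
the one of some \<open>v\<close>; the preceding lemma shows that \<open>v\<close> is coreflected, so \<open>v\<close> may be replaced by
\<open>L (U v)\<close>, and the original algebra is isomorphic to the one of \<open>U v\<close>.\<close>

lemma comparison_essentially_surjective:
  assumes ff: "\<forall>y \<in> Obj D. \<forall>y' \<in> Obj D.
      bij_betw (FArr G) (Hom D y y') (A.alg_hom (A.comparison_alg y) (A.comparison_alg y'))"
    and es: "\<forall>X. A.alg X \<longrightarrow> (\<exists>y \<in> Obj D. \<exists>h \<in> A.alg_hom (A.comparison_alg y) X. iso_arr C h)"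
    and W: "A'.alg W"
  shows "\<exists>z \<in> Obj D'. \<exists>h \<in> A'.alg_hom (A'.comparison_alg z) W. iso_arr C' h"
proof -
  obtain w a where W_eq: "W = (w, a)" by (metis surj_pair)
  let ?x = "FObj LC w"
  let ?T = "FObj G (FObj F ?x)"
  have w: "w \<in> Obj C'" and a: "a \<in> Arr C'" "Dom C' a = FObj UC ?T" "Cod C' a = w"
    and a_unit: "a \<cdot>\<^bsub>C'\<^esub> \<eta>' w = Ide C' w"
    and a_mult: "a \<cdot>\<^bsub>C'\<^esub> FArr G' (\<epsilon>' (FObj F' w)) = a \<cdot>\<^bsub>C'\<^esub> FArr G' (FArr F' a)"
    using W[unfolded W_eq A'.alg_iff] by auto
  have iso_T: "iso_arr C (cC ?T)" using counit_iso_G_L[of "FObj F' w"] w by simp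
  have iso_TT: "iso_arr C (cC (FObj G (FObj F ?T)))"
    by (rule counit_iso_G[of _ "\<epsilon> (FObj LD (FObj F' w))" "FObj F' w"]) (use w in simp_all)
  obtain \<alpha> where \<alpha>: "\<alpha> \<in> Arr C" "Dom C \<alpha> = ?T" "Cod C \<alpha> = ?x" "FArr UC \<alpha> = a"
    by (rule C.U_lift[OF iso_T, of ?x a]) (use w a in \<open>simp_all add: Hom_def\<close>)
  have La: "FArr LC a = \<alpha> \<cdot>\<^bsub>C\<^esub> cC ?T"
    using C.counit_nat[OF \<alpha>(1)] \<alpha> w a by simp
  have FLa: "FArr LD (FArr F' a) = FArr F \<alpha> \<cdot>\<^bsub>D\<^esub> cD (FObj F ?T)"
    using arg_cong[OF La, of "FArr F"] \<alpha>(1-3) a w by simp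
  have "A.alg (?x, \<alpha>)"
  proof -
    have 1: "\<alpha> \<cdot>\<^bsub>C\<^esub> \<eta> ?x = Ide C ?x"
      by (rule C.eq_if_U_eq) (use \<alpha> w a_unit in \<open>simp_all add: \<eta>'_def\<close>)
    have "FArr UC (\<alpha> \<cdot>\<^bsub>C\<^esub> FArr G (\<epsilon> (FObj F ?x))) = FArr UC (\<alpha> \<cdot>\<^bsub>C\<^esub> FArr G (FArr F \<alpha>))"
    proof (rule C.L.Src.iso_arr_cancel_right)
      show "iso_arr C' (FArr UC (FArr G (cD (FObj F ?T))))"
        using iso_U_T_counit[OF _ iso_T] w by simp
      have "FArr UC (\<alpha> \<cdot>\<^bsub>C\<^esub> FArr G (\<epsilon> (FObj F ?x))) \<cdot>\<^bsub>C'\<^esub> FArr UC (FArr G (cD (FObj F ?T))) =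
          a \<cdot>\<^bsub>C'\<^esub> FArr G' (\<epsilon>' (FObj F' w))"
        using \<alpha> w a by (simp add: L_U_counit)
      also have "\<dots> = FArr UC (\<alpha> \<cdot>\<^bsub>C\<^esub> FArr G (FArr F \<alpha>)) \<cdot>\<^bsub>C'\<^esub>
          FArr UC (FArr G (cD (FObj F ?T)))"
        unfolding a_mult using \<alpha> w a by (simp add: FLa)
      finally show "FArr UC (\<alpha> \<cdot>\<^bsub>C\<^esub> FArr G (\<epsilon> (FObj F ?x))) \<cdot>\<^bsub>C'\<^esub>
          FArr UC (FArr G (cD (FObj F ?T))) =
          FArr UC (\<alpha> \<cdot>\<^bsub>C\<^esub> FArr G (FArr F \<alpha>)) \<cdot>\<^bsub>C'\<^esub> FArr UC (FArr G (cD (FObj F ?T)))" .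
    qed (use \<alpha>(1-3) w in simp_all)
    then have 2: "\<alpha> \<cdot>\<^bsub>C\<^esub> FArr G (\<epsilon> (FObj F ?x)) = \<alpha> \<cdot>\<^bsub>C\<^esub> FArr G (FArr F \<alpha>)"
      by (intro C.eq_if_U_eq) (use iso_TT \<alpha>(1-3) w in simp_all)
    show ?thesis using 1 2 \<alpha>(1-3) w by (simp add: A.alg_iff)
  qed
  then obtain v \<theta> where v: "v \<in> Obj D" and \<theta>_hom: "\<theta> \<in> A.alg_hom (A.comparison_alg v) (?x, \<alpha>)"
    and \<theta>_iso: "iso_arr C \<theta>"
    using es by blast
  have \<theta>: "\<theta> \<in> Arr C" "Dom C \<theta> = FObj G v" "Cod C \<theta> = ?x"
    "\<theta> \<cdot>\<^bsub>C\<^esub> FArr G (\<epsilon> v) = \<alpha> \<cdot>\<^bsub>C\<^esub> FArr G (FArr F \<theta>)"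
    using \<theta>_hom by (auto simp: A.alg_hom_def Hom_def)
  let ?z = "FObj UD v"
  let ?u = "FObj G (FObj LD ?z)"
  have z: "?z \<in> Obj D'" using v by simp
  have iso_v: "iso_arr D (cD v)" by (rule counit_iso_if_G_coreflected[OF ff v w \<theta>(1-3)])
  define \<psi> where "\<psi> = \<theta> \<cdot>\<^bsub>C\<^esub> FArr G (cD v)"
  have \<psi>: "\<psi> \<in> Arr C" "Dom C \<psi> = ?u" "Cod C \<psi> = ?x"
    using \<theta> v by (simp_all add: \<psi>_def)
  have \<psi>_iso: "iso_arr C \<psi>"
    unfolding \<psi>_def by (rule A.F.Src.iso_arr_Comp[OF A.G.iso_arr_FArr[OF iso_v] \<theta>_iso]) (use \<theta> v in simp)
  have "\<psi> \<cdot>\<^bsub>C\<^esub> FArr G (\<epsilon> (FObj LD ?z)) = \<theta> \<cdot>\<^bsub>C\<^esub> FArr G (cD v \<cdot>\<^bsub>D\<^esub> \<epsilon> (FObj LD ?z))"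
    using \<theta>(1-3) v by (simp add: \<psi>_def)
  also have "cD v \<cdot>\<^bsub>D\<^esub> \<epsilon> (FObj LD ?z) = \<epsilon> v \<cdot>\<^bsub>D\<^esub> FArr F (FArr G (cD v))"
    using A.counit_nat[of "cD v"] v by simp
  also have "\<theta> \<cdot>\<^bsub>C\<^esub> FArr G (\<epsilon> v \<cdot>\<^bsub>D\<^esub> FArr F (FArr G (cD v))) =
      (\<theta> \<cdot>\<^bsub>C\<^esub> FArr G (\<epsilon> v)) \<cdot>\<^bsub>C\<^esub> FArr G (FArr F (FArr G (cD v)))"
    using \<theta>(1-3) v by simp
  also have "\<dots> = \<alpha> \<cdot>\<^bsub>C\<^esub> FArr G (FArr F \<psi>)"
    unfolding \<theta>(4) using \<theta>(1-3) v \<alpha>(1-3) w by (simp add: \<psi>_def)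
  finally have \<psi>_hom: "\<psi> \<cdot>\<^bsub>C\<^esub> FArr G (\<epsilon> (FObj LD ?z)) = \<alpha> \<cdot>\<^bsub>C\<^esub> FArr G (FArr F \<psi>)" .
  have L\<psi>: "FArr LC (FArr UC \<psi>) = \<psi> \<cdot>\<^bsub>C\<^esub> cC ?u"
    using C.counit_nat[OF \<psi>(1)] \<psi> w v by simp
  have FL\<psi>: "FArr LD (FArr F' (FArr UC \<psi>)) = FArr F \<psi> \<cdot>\<^bsub>D\<^esub> cD (FObj F ?u)"
    using arg_cong[OF L\<psi>, of "FArr F"] \<psi> v w by simp
  have "FArr UC \<psi> \<cdot>\<^bsub>C'\<^esub> FArr G' (\<epsilon>' ?z) =
      FArr UC (\<psi> \<cdot>\<^bsub>C\<^esub> FArr G (\<epsilon> (FObj LD ?z))) \<cdot>\<^bsub>C'\<^esub> FArr UC (FArr G (cD (FObj F ?u)))"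
    unfolding G'_counit[OF z] using \<psi> v by simp
  also have "\<dots> = a \<cdot>\<^bsub>C'\<^esub> FArr G' (FArr F' (FArr UC \<psi>))"
    unfolding \<psi>_hom G'_Arr FL\<psi> using \<psi> v \<alpha> w a by simp
  finally have "FArr UC \<psi> \<in> A'.alg_hom (A'.comparison_alg ?z) W"
    using \<psi> v w by (simp add: A'.alg_hom_def Hom_def W_eq)
  then show ?thesis using z C.U.iso_arr_FArr[OF \<psi>_iso] by blast
qed

theorem monadic':
  assumes "monadic_adjunction C D F G \<eta> \<epsilon>"
  shows "monadic_adjunction C' D' F' G' \<eta>' \<epsilon>'"
proof -
  have ff: "\<forall>y \<in> Obj D. \<forall>y' \<in> Obj D.
      bij_betw (FArr G) (Hom D y y') (A.alg_hom (A.comparison_alg y) (A.comparison_alg y'))"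
    and es: "\<forall>X. A.alg X \<longrightarrow> (\<exists>y \<in> Obj D. \<exists>h \<in> A.alg_hom (A.comparison_alg y) X. iso_arr C h)"
    using assms A.monadic_iff by blast+
  have "bij_betw (FArr G') (Hom D' z z') (A'.alg_hom (A'.comparison_alg z) (A'.comparison_alg z'))"
    if z: "z \<in> Obj D'" "z' \<in> Obj D'" for z z'
    unfolding bij_betw_def
  proof
    show "inj_on (FArr G') (Hom D' z z')" by (rule comparison_faithful[OF ff z])
    have "FArr G' k \<in> A'.alg_hom (A'.comparison_alg z) (A'.comparison_alg z')" if k: "k \<in> Hom D' z z'" for k
      using arg_cong[OF A'.counit_nat[of k], of "FArr G'"] k z
        A'.G.FArr_Comp[of "FArr F' (FArr G' k)" "\<epsilon>' z'"] A'.G.FArr_Comp[of "\<epsilon>' z" k]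
      by (auto simp: A'.alg_hom_def Hom_def simp del: G'_Arr G'_Obj A'.G.FArr_Comp)
    then show "FArr G' ` Hom D' z z' = A'.alg_hom (A'.comparison_alg z) (A'.comparison_alg z')"
      using comparison_full[OF ff z] by blast
  qed
  then show ?thesis
    unfolding A'.monadic_iff using comparison_essentially_surjective[OF ff es] by blast
qed

end

section \<open>Slices and pullbacks\<close>

lemma Obj_slice [simp]: "f \<in> Obj (slice X b) \<longleftrightarrow> f \<in> Arr X \<and> Cod X f = b"
  and Dom_slice [simp]: "Dom (slice X b) (f, h, g) = f"
  and Cod_slice [simp]: "Cod (slice X b) (f, h, g) = g"
  and Ide_slice [simp]: "Ide (slice X b) f = (f, Ide X (Dom X f), f)"
  and Comp_slice [simp]: "(g', k, e) \<cdot>\<^bsub>slice X b\<^esub> (f, h, g) = (f, k \<cdot>\<^bsub>X\<^esub> h, e)"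
  by (simp_all add: slice_def)

lemma Arr_slice [simp]:
  "(f, h, g) \<in> Arr (slice X b) \<longleftrightarrow>
     f \<in> Arr X \<and> Cod X f = b \<and> g \<in> Arr X \<and> Cod X g = b \<and>
     h \<in> Arr X \<and> Dom X h = Dom X f \<and> Cod X h = Dom X g \<and> g \<cdot>\<^bsub>X\<^esub> h = f"
  by (auto simp: slice_def Hom_def)

lemma slice_push_simps [simp]:
  "FObj (slice_push X p) f = p \<cdot>\<^bsub>X\<^esub> f"
  "FArr (slice_push X p) (f, h, g) = (p \<cdot>\<^bsub>X\<^esub> f, h, p \<cdot>\<^bsub>X\<^esub> g)"
  by (simp_all add: slice_push_def)

text \<open>The counit of the adjunction between \<open>p\<^sub>!\<close> and \<open>R\<close> at \<open>f\<close> is a commutative square on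
\<open>p\<close> and \<open>f\<close>, and any such square is an arrow from some \<open>p\<^sub>! s\<close> to \<open>f\<close> in the slice. Unique
transposition along the adjunction is the universal property of the pullback.\<close>

lemma right_adjoint_slice_push_imp_pullbacks:
  assumes "category X" and p: "p \<in> Arr X"
    and adj: "adjunction (slice X (Dom X p)) (slice X (Cod X p)) (slice_push X p) R \<eta> \<epsilon>"
  shows "has_pullbacks_along X p"
  unfolding has_pullbacks_along_def
proof (intro ballI impI)
  interpret X: category X by fact
  interpret A: adjoint_functors "slice X (Dom X p)" "slice X (Cod X p)" "slice_push X p" R \<eta> \<epsilon>
    by unfold_locales (rule adj)
  fix f assume f: "f \<in> Arr X" "Cod X f = Cod X p"
  define u where "u = FObj R f"
  have u: "u \<in> Arr X" "Cod X u = Dom X p"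
    using A.G.FObj_closed[of f] f by (simp_all add: u_def)
  obtain v where \<epsilon>f: "\<epsilon> f = (p \<cdot>\<^bsub>X\<^esub> u, v, f)"
    using A.counit(2,3)[of f] f by (cases "\<epsilon> f") (simp add: u_def)
  have v: "v \<in> Arr X" "Dom X v = Dom X u" "Cod X v = Dom X f" "f \<cdot>\<^bsub>X\<^esub> v = p \<cdot>\<^bsub>X\<^esub> u"
    using A.counit(1)[of f] f p u by (simp_all add: \<epsilon>f)
  have "\<exists>!w. w \<in> Hom X (Dom X s) (Dom X u) \<and> u \<cdot>\<^bsub>X\<^esub> w = s \<and> v \<cdot>\<^bsub>X\<^esub> w = t"
    if "s \<in> Arr X" "t \<in> Arr X" and
      "Dom X s = Dom X t \<and> Cod X s = Dom X p \<and> Cod X t = Dom X f \<and> p \<cdot>\<^bsub>X\<^esub> s = f \<cdot>\<^bsub>X\<^esub> t"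
    for s t
  proof -
    have s: "s \<in> Arr X" "Cod X s = Dom X p" and t: "t \<in> Arr X" "Dom X t = Dom X s" "Cod X t = Dom X f"
      and eq: "p \<cdot>\<^bsub>X\<^esub> s = f \<cdot>\<^bsub>X\<^esub> t"
      using that by auto
    let ?P = "\<lambda>h. h \<in> Hom (slice X (Dom X p)) s u \<and>
        \<epsilon> f \<cdot>\<^bsub>slice X (Cod X p)\<^esub> FArr (slice_push X p) h = (p \<cdot>\<^bsub>X\<^esub> s, t, f)"
    have ex1: "\<exists>!h. ?P h"
      unfolding u_def
      by (rule A.ex1_transpose) (use f p s t eq in \<open>simp_all add: Hom_def\<close>)
    have P: "?P (s, w, u) \<longleftrightarrow> w \<in> Hom X (Dom X s) (Dom X u) \<and> u \<cdot>\<^bsub>X\<^esub> w = s \<and> v \<cdot>\<^bsub>X\<^esub> w = t" for w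
      using s t u by (auto simp: Hom_def \<epsilon>f)
    obtain h where h: "?P h" using ex1 by blast
    then obtain w where "h = (s, w, u)" by (cases h) (auto simp: Hom_def)
    then have "?P (s, w, u)" using h by simp
    moreover have "w' = w" if "?P (s, w', u)" for w'
      using ex1 that \<open>?P (s, w, u)\<close> by blast
    ultimately show ?thesis unfolding P by blast
  qed
  then have "is_pullback X p f u v"
    unfolding is_pullback_def using u v(1-3) v(4)[symmetric] by simp
  then show "\<exists>u v. is_pullback X p f u v" by blast
qed

section \<open>Strict coreflections preserve effective descent\<close>

text \<open>Strictness says that the coreflective subcategory is closed under sources of arrows into it. For
the subcategory on a single initial object this is strictness of the initial object.\<close>

locale strict_coreflection = coreflection X B L U c
  for X :: "('o, 'm) cat" and B :: "('p, 'n) cat"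
    and L :: "('p, 'n, 'o, 'm) functr" and U :: "('o, 'm, 'p, 'n) functr" and c :: "'o \<Rightarrow> 'm" +
  assumes strict: "\<lbrakk>g \<in> Arr X; w \<in> Obj B; Cod X g = FObj L w\<rbrakk> \<Longrightarrow> iso_arr X (c (Dom X g))"
begin

definition slice_L :: "'o \<Rightarrow> ('n, 'n \<times> 'n \<times> 'n, 'm, 'm \<times> 'm \<times> 'm) functr" where
  "slice_L x = \<lparr>FObj = \<lambda>f. c x \<cdot>\<^bsub>X\<^esub> FArr L f,
     FArr = \<lambda>(f, h, g). (c x \<cdot>\<^bsub>X\<^esub> FArr L f, FArr L h, c x \<cdot>\<^bsub>X\<^esub> FArr L g)\<rparr>"

definition slice_U :: "('m, 'm \<times> 'm \<times> 'm, 'n, 'n \<times> 'n \<times> 'n) functr" where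
  "slice_U = \<lparr>FObj = FArr U, FArr = \<lambda>(f, h, g). (FArr U f, FArr U h, FArr U g)\<rparr>"

definition slice_c :: "'o \<Rightarrow> 'm \<Rightarrow> 'm \<times> 'm \<times> 'm" where
  "slice_c x f = (c x \<cdot>\<^bsub>X\<^esub> FArr L (FArr U f), c (Dom X f), f)"

lemma slice_simps [simp]:
  "FObj (slice_L x) k = c x \<cdot>\<^bsub>X\<^esub> FArr L k"
  "FArr (slice_L x) (k, l, m) = (c x \<cdot>\<^bsub>X\<^esub> FArr L k, FArr L l, c x \<cdot>\<^bsub>X\<^esub> FArr L m)"
  "FObj slice_U f = FArr U f"
  "FArr slice_U (f, h, g) = (FArr U f, FArr U h, FArr U g)"
  by (simp_all add: slice_L_def slice_U_def)

text \<open>A coreflection induces one on each slice. The embedding sends \<open>k : d \<rightarrow> U x\<close> to its transpose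
\<open>c x \<cdot> L k\<close>, and the counit at \<open>f\<close> is the counit at the domain of \<open>f\<close>; the required triangle is
naturality of \<open>c\<close>.\<close>

lemma coreflection_slice:
  assumes x: "x \<in> Obj X"
  shows "coreflection (slice X x) (slice B (FObj U x)) (slice_L x) slice_U (slice_c x)"
proof -
  let ?X = "slice X x" and ?B = "slice B (FObj U x)"
  interpret SX: category ?X by (rule category_slice) (rule L.Tgt.category_axioms)
  interpret SB: category ?B by (rule category_slice) (rule L.Src.category_axioms)
  have L: "is_functor ?B ?X (slice_L x)"
    unfolding is_functor_def
  proof (intro conjI ballI impI SX.category_axioms SB.category_axioms)
    fix K assume "K \<in> Arr ?B"
    then show "FArr (slice_L x) K \<in> Hom ?X (FObj (slice_L x) (Dom ?B K)) (FObj (slice_L x) (Cod ?B K))"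
      using x by (cases K) (auto simp: Hom_def)
  next
    fix K M assume "K \<in> Arr ?B" "M \<in> Arr ?B" "Cod ?B K = Dom ?B M"
    then show "FArr (slice_L x) (M \<cdot>\<^bsub>?B\<^esub> K) = FArr (slice_L x) M \<cdot>\<^bsub>?X\<^esub> FArr (slice_L x) K"
      by (cases K; cases M) auto
  qed (use x in auto)
  have U: "is_functor ?X ?B slice_U"
    unfolding is_functor_def
  proof (intro conjI ballI impI SX.category_axioms SB.category_axioms)
    fix K assume "K \<in> Arr ?X"
    then show "FArr slice_U K \<in> Hom ?B (FObj slice_U (Dom ?X K)) (FObj slice_U (Cod ?X K))"
      using x by (cases K) (auto simp: Hom_def)
  next
    fix K M assume "K \<in> Arr ?X" "M \<in> Arr ?X" "Cod ?X K = Dom ?X M"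
    then show "FArr slice_U (M \<cdot>\<^bsub>?X\<^esub> K) = FArr slice_U M \<cdot>\<^bsub>?B\<^esub> FArr slice_U K"
      by (cases K; cases M) auto
  qed (use x in auto)
  show ?thesis
  proof (intro_locales)
    show "functor_between ?B ?X (slice_L x)" by unfold_locales (rule L)
    show "functor_between ?X ?B slice_U" by unfold_locales (rule U)
    show "coreflection_axioms ?X ?B (slice_L x) slice_U (slice_c x)"
    proof
      fix f assume f: "f \<in> Obj ?X"
      show "slice_c x f \<in> Hom ?X (FObj (slice_L x) (FObj slice_U f)) f"
        using f x counit_nat[of f] by (simp add: slice_c_def Hom_def)
      show "FArr slice_U (slice_c x f) = Ide ?B (FObj slice_U f)"
        using f x by (simp add: slice_c_def)
    next
      fix K assume K: "K \<in> Arr ?X"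
      obtain f h g where K_eq: "K = (f, h, g)" by (cases K)
      show "K \<cdot>\<^bsub>?X\<^esub> slice_c x (Dom ?X K) =
          slice_c x (Cod ?X K) \<cdot>\<^bsub>?X\<^esub> FArr (slice_L x) (FArr slice_U K)"
        using K counit_nat[of h] by (simp add: K_eq slice_c_def)
    next
      fix K assume "K \<in> Arr ?B"
      then show "FArr slice_U (FArr (slice_L x) K) = K"
        using x by (cases K) auto
    qed (use x in \<open>auto simp: slice_c_def\<close>)
  qed
qed

lemma iso_slice_c:
  assumes x: "x \<in> Obj X" and f: "f \<in> Arr X" "Cod X f = x" and iso: "iso_arr X (c (Dom X f))"
  shows "iso_arr (slice X x) (slice_c x f)"
proof -
  obtain i where i: "i \<in> Arr X" "Dom X i = Dom X f" "Cod X i = FObj L (FObj U (Dom X f))"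
    "i \<cdot>\<^bsub>X\<^esub> c (Dom X f) = Ide X (FObj L (FObj U (Dom X f)))" "c (Dom X f) \<cdot>\<^bsub>X\<^esub> i = Ide X (Dom X f)"
    using iso L.Tgt.iso_arrE f by (metis L.Tgt.Dom_closed counit_Arr)
  have c: "c x \<cdot>\<^bsub>X\<^esub> FArr L (FArr U f) = f \<cdot>\<^bsub>X\<^esub> c (Dom X f)" using counit_nat[OF f(1)] f by simp
  let ?g = "f \<cdot>\<^bsub>X\<^esub> c (Dom X f)"
  have g: "?g \<in> Arr X" "Dom X ?g = FObj L (FObj U (Dom X f))" "Cod X ?g = x"
    using f by simp_all
  have "?g \<cdot>\<^bsub>X\<^esub> i = f" using f i by simp
  then have "iso_arr (slice X x) (?g, c (Dom X f), f)"
    unfolding iso_arr_def using f i g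
    by (auto simp: Hom_def intro!: bexI[of _ "(f, i, ?g)"] simp del: L.Tgt.Comp_assoc)
  then show ?thesis unfolding slice_c_def c .
qed

text \<open>Composition with \<open>p\<close> commutes with the coreflections of the slices by naturality of \<open>c\<close>. An arrow in
a slice has an underlying arrow between the domains, so strictness passes to slices, and since
composition with \<open>p\<close> does not change domains it also holds across \<open>p\<^sub>!\<close>.\<close>

theorem U_preserves_effective_descent: "preserves_effective_descent X B U"
  unfolding preserves_effective_descent_def
proof (intro conjI allI impI U.is_functor)
  fix p assume "effective_descent X p"
  then obtain R \<eta> \<epsilon> where p: "p \<in> Arr X"
    and mon: "monadic_adjunction (slice X (Dom X p)) (slice X (Cod X p)) (slice_push X p) R \<eta> \<epsilon>"
    by (auto simp: effective_descent_def)
  let ?x = "Dom X p" and ?y = "Cod X p" and ?k = "FArr U p"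
  have adj: "adjunction (slice X ?x) (slice X ?y) (slice_push X p) R \<eta> \<epsilon>"
    using mon by (simp add: monadic_adjunction_def)
  have k: "?k \<in> Arr B" "Dom B ?k = FObj U ?x" "Cod B ?k = FObj U ?y" using p by simp_all
  have push: "is_functor (slice B (FObj U ?x)) (slice B (FObj U ?y)) (slice_push B ?k)"
    using is_functor_slice_push[OF L.Src.category_axioms k(1)] k by simp
  have c_p: "c ?y \<cdot>\<^bsub>X\<^esub> FArr L ?k = p \<cdot>\<^bsub>X\<^esub> c ?x" using counit_nat[OF p] by simp
  have c_p': "c ?y \<cdot>\<^bsub>X\<^esub> FArr L ?k \<cdot>\<^bsub>X\<^esub> FArr L m = p \<cdot>\<^bsub>X\<^esub> c ?x \<cdot>\<^bsub>X\<^esub> FArr L m"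
    if "m \<in> Arr B" "Cod B m = FObj U ?x" for m
    using arg_cong[OF c_p, of "\<lambda>q. q \<cdot>\<^bsub>X\<^esub> FArr L m"] that p by simp
  interpret CA: coreflected_adjunction "slice X ?x" "slice X ?y" "slice_push X p" R \<eta> \<epsilon>
    "slice B (FObj U ?x)" "slice B (FObj U ?y)" "slice_push B ?k"
    "slice_L ?x" slice_U "slice_L ?y" slice_U "slice_c ?x" "slice_c ?y"
  proof (intro_locales)
    show "adjoint_functors (slice X ?x) (slice X ?y) (slice_push X p) R \<eta> \<epsilon>"
      by unfold_locales (rule adj)
    show "functor_between (slice B (FObj U ?x)) (slice B (FObj U ?y)) (slice_push B ?k)"
      by unfold_locales (rule push)
    interpret Cx: coreflection "slice X ?x" "slice B (FObj U ?x)" "slice_L ?x" slice_U "slice_c ?x"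
      by (rule coreflection_slice) (use p in simp)
    interpret Cy: coreflection "slice X ?y" "slice B (FObj U ?y)" "slice_L ?y" slice_U "slice_c ?y"
      by (rule coreflection_slice) (use p in simp)
    show "functor_between (slice B (FObj U ?x)) (slice X ?x) (slice_L ?x)"
      "functor_between (slice X ?x) (slice B (FObj U ?x)) slice_U"
      "functor_between (slice B (FObj U ?y)) (slice X ?y) (slice_L ?y)"
      "functor_between (slice X ?y) (slice B (FObj U ?y)) slice_U"
      "coreflection_axioms (slice X ?x) (slice B (FObj U ?x)) (slice_L ?x) slice_U (slice_c ?x)"
      "coreflection_axioms (slice X ?y) (slice B (FObj U ?y)) (slice_L ?y) slice_U (slice_c ?y)"
      using Cx.coreflection_axioms Cy.coreflection_axioms unfolding coreflection_def by blast+
    show "coreflected_adjunction_axioms (slice X ?x) (slice X ?y) (slice_push X p)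
        (slice B (FObj U ?x)) (slice B (FObj U ?y)) (slice_push B ?k)
        (slice_L ?x) slice_U (slice_L ?y) slice_U (slice_c ?x) (slice_c ?y)"
    proof
      fix f assume f: "f \<in> Obj (slice X ?x)"
      show "FObj slice_U (FObj (slice_push X p) f) = FObj (slice_push B ?k) (FObj slice_U f)"
        using f p by simp
      show "FArr (slice_push X p) (slice_c ?x f) = slice_c ?y (FObj (slice_push X p) f)"
        using f p c_p' by (simp add: slice_c_def)
    next
      fix h assume "h \<in> Obj (slice B (FObj U ?x))"
      then show "FObj (slice_push X p) (FObj (slice_L ?x) h) =
          FObj (slice_L ?y) (FObj (slice_push B ?k) h)"
        using p c_p' by simp
    next
      fix K assume "K \<in> Arr (slice B (FObj U ?x))"
      then show "FArr (slice_push X p) (FArr (slice_L ?x) K) =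
          FArr (slice_L ?y) (FArr (slice_push B ?k) K)"
        using p c_p' by (cases K) auto
    next
      fix K assume "K \<in> Arr (slice X ?x)"
      then show "FArr slice_U (FArr (slice_push X p) K) = FArr (slice_push B ?k) (FArr slice_U K)"
        using p by (cases K) auto
    next
      fix f z K
      assume f: "f \<in> Obj (slice X ?x)" and z: "z \<in> Obj (slice B (FObj U ?y))"
        and K: "K \<in> Arr (slice X ?y)" "Dom (slice X ?y) K = FObj (slice_push X p) f"
          "Cod (slice X ?y) K = FObj (slice_L ?y) z"
      obtain h where h: "K = (p \<cdot>\<^bsub>X\<^esub> f, h, c ?y \<cdot>\<^bsub>X\<^esub> FArr L z)" using K by (cases K) simp
      have "iso_arr X (c (Dom X h))"
        by (rule strict[of h "Dom B z"]) (use K z p in \<open>simp_all add: h\<close>)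
      then show "iso_arr (slice X ?x) (slice_c ?x f)"
        using K f p by (intro iso_slice_c) (simp_all add: h)
    next
      fix z K
      assume z: "z \<in> Obj (slice B (FObj U ?y))"
        and K: "K \<in> Arr (slice X ?y)" "Cod (slice X ?y) K = FObj (slice_L ?y) z"
      obtain f h where h: "K = (f, h, c ?y \<cdot>\<^bsub>X\<^esub> FArr L z)" using K by (cases K) simp
      have "iso_arr X (c (Dom X h))"
        by (rule strict[of h "Dom B z"]) (use K z p in \<open>simp_all add: h\<close>)
      then show "iso_arr (slice X ?y) (slice_c ?y (Dom (slice X ?y) K))"
        using K p by (simp add: h iso_slice_c)
    qed
  qed
  have "monadic_adjunction (slice B (Dom B ?k)) (slice B (Cod B ?k)) (slice_push B ?k) CA.G' CA.\<eta>' CA.\<epsilon>'"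
    using CA.monadic'[OF mon] k by simp
  moreover have "has_pullbacks_along B ?k"
    by (rule right_adjoint_slice_push_imp_pullbacks[OF L.Src.category_axioms k(1)])
      (use CA.adjunction' k in simp)
  ultimately show "effective_descent B ?k"
    unfolding effective_descent_def using k(1) by blast
qed

end

section \<open>The scone\<close>

definition initial_arr :: "('o, 'm) cat \<Rightarrow> 'o \<Rightarrow> 'o \<Rightarrow> 'm" where
  "initial_arr C z x = (THE f. f \<in> Hom C z x)"

lemma initial_arr:
  assumes "initial_obj C z" "x \<in> Obj C"
  shows "initial_arr C z x \<in> Arr C" "Dom C (initial_arr C z x) = z" "Cod C (initial_arr C z x) = x"
proof -
  have "initial_arr C z x \<in> Hom C z x"
    using assms unfolding initial_obj_def initial_arr_def by (metis theI')
  then show "initial_arr C z x \<in> Arr C" "Dom C (initial_arr C z x) = z" "Cod C (initial_arr C z x) = x"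
    by (auto simp: Hom_def)
qed

lemma initial_arr_unique:
  assumes "category C" "initial_obj C z" "f \<in> Arr C" "Dom C f = z"
  shows "f = initial_arr C z (Cod C f)"
proof -
  have "f \<in> Hom C z (Cod C f)" using assms by (simp add: Hom_def)
  moreover have "Cod C f \<in> Obj C" using assms by (simp add: category.Cod_closed)
  ultimately show ?thesis
    using assms(2) unfolding initial_obj_def initial_arr_def by (metis the1_equality)
qed

text \<open>The left adjoint of the projection, which sends \<open>b\<close> to the unique arrow from the initial object
\<open>z\<close> to \<open>\<Phi> b\<close>.\<close>

definition scone_L :: "('a, 'm) cat \<Rightarrow> ('b, 'n) cat \<Rightarrow> ('b, 'n, 'a, 'm) functr \<Rightarrow> 'a \<Rightarrow>
    ('b, 'n, 'a \<times> 'b \<times> 'm, ('a \<times> 'b \<times> 'm) \<times> ('m \<times> 'n) \<times> ('a \<times> 'b \<times> 'm)) functr" where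
  "scone_L A B \<Phi> z =
     (let ob = (\<lambda>b. (z, b, initial_arr A z (FObj \<Phi> b)))
      in \<lparr>FObj = ob, FArr = \<lambda>k. (ob (Dom B k), (Ide A z, k), ob (Cod B k))\<rparr>)"

definition scone_counit :: "('a, 'm) cat \<Rightarrow> ('b, 'n) cat \<Rightarrow> ('b, 'n, 'a, 'm) functr \<Rightarrow> 'a \<Rightarrow>
    'a \<times> 'b \<times> 'm \<Rightarrow> ('a \<times> 'b \<times> 'm) \<times> ('m \<times> 'n) \<times> ('a \<times> 'b \<times> 'm)" where
  "scone_counit A B \<Phi> z =
     (\<lambda>(a, b, f). (FObj (scone_L A B \<Phi> z) b, (initial_arr A z a, Ide B b), (a, b, f)))"

lemma Obj_scone [simp]:
  "(a, b, f) \<in> Obj (scone A B \<Phi>) \<longleftrightarrow>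
     a \<in> Obj A \<and> b \<in> Obj B \<and> f \<in> Arr A \<and> Dom A f = a \<and> Cod A f = FObj \<Phi> b"
  by (auto simp: scone_def Hom_def)

lemma Arr_scone [simp]:
  "((a, b, f), (h, k), (a', b', f')) \<in> Arr (scone A B \<Phi>) \<longleftrightarrow>
     (a, b, f) \<in> Obj (scone A B \<Phi>) \<and> (a', b', f') \<in> Obj (scone A B \<Phi>) \<and>
     h \<in> Arr A \<and> Dom A h = a \<and> Cod A h = a' \<and> k \<in> Arr B \<and> Dom B k = b \<and> Cod B k = b' \<and>
     f' \<cdot>\<^bsub>A\<^esub> h = FArr \<Phi> k \<cdot>\<^bsub>A\<^esub> f"
  by (auto simp: scone_def Hom_def)

lemma scone_simps [simp]:
  "Dom (scone A B \<Phi>) (s, hk, t) = s"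
  "Cod (scone A B \<Phi>) (s, hk, t) = t"
  "Ide (scone A B \<Phi>) (a, b, f) = ((a, b, f), (Ide A a, Ide B b), (a, b, f))"
  "(t', (h', k'), u) \<cdot>\<^bsub>scone A B \<Phi>\<^esub> (s, (h, k), t) = (s, (h' \<cdot>\<^bsub>A\<^esub> h, k' \<cdot>\<^bsub>B\<^esub> k), u)"
  "FObj scone_forget (a, b, f) = b"
  "FArr scone_forget (s, (h, k), t) = k"
  by (simp_all add: scone_def scone_forget_def)

text \<open>All equations between \<open>A\<close>-components compare arrows out of the initial object. An arrow
\<open>(a, b, f) \<rightarrow> (z, w, _)\<close> has a component \<open>a \<rightarrow> z\<close>, so strictness of \<open>z\<close> makes \<open>a\<close> initial; then the
unique arrow \<open>z \<rightarrow> a\<close> is invertible, and with it the counit at \<open>(a, b, f)\<close>.\<close>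

lemma strict_coreflection_scone:
  assumes \<Phi>: "is_functor B A \<Phi>" and strict: "strict_initial_obj A z"
  shows "strict_coreflection (scone A B \<Phi>) B (scone_L A B \<Phi> z) scone_forget (scone_counit A B \<Phi> z)"
proof -
  interpret \<Phi>: functor_between B A \<Phi> by unfold_locales (rule \<Phi>)
  let ?S = "scone A B \<Phi>" and ?L = "scone_L A B \<Phi> z" and ?i = "initial_arr A z"
  interpret S: category ?S by (rule category_scone[OF \<Phi>])
  have init: "initial_obj A z" using strict by (simp add: strict_initial_obj_def)
  then have z [simp]: "z \<in> Obj A" by (simp add: initial_obj_def)
  note i [simp] = initial_arr[OF init]
  have i_eq: "f = g" if "f \<in> Arr A" "g \<in> Arr A" "Dom A f = z" "Dom A g = z" "Cod A f = Cod A g" for f g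
    using initial_arr_unique[OF \<Phi>.Tgt.category_axioms init] that by metis
  have L_Obj [simp]: "FObj ?L b = (z, b, ?i (FObj \<Phi> b))" for b
    by (simp add: scone_L_def)
  have L_Arr [simp]: "FArr ?L k = (FObj ?L (Dom B k), (Ide A z, k), FObj ?L (Cod B k))" for k
    by (simp add: scone_L_def)
  have L: "is_functor B ?S ?L"
    unfolding is_functor_def
  proof (intro conjI ballI impI S.category_axioms \<Phi>.Src.category_axioms)
    fix k assume "k \<in> Arr B"
    then show "FArr ?L k \<in> Hom ?S (FObj ?L (Dom B k)) (FObj ?L (Cod B k))"
      by (auto simp: Hom_def intro!: i_eq)
  next
    show "FArr ?L (Ide B b) = Ide ?S (FObj ?L b)" if "b \<in> Obj B" for b
      using that by simp
  qed simp_all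
  show ?thesis
  proof (intro_locales)
    show "functor_between B ?S ?L" by unfold_locales (rule L)
    show "functor_between ?S B scone_forget" by unfold_locales (rule is_functor_scone_forget[OF \<Phi>])
    show "coreflection_axioms ?S B ?L scone_forget (scone_counit A B \<Phi> z)"
    proof
      fix u assume u: "u \<in> Obj ?S"
      obtain a b f where u_eq: "u = (a, b, f)" by (metis surj_pair)
      show "scone_counit A B \<Phi> z u \<in> Hom ?S (FObj ?L (FObj scone_forget u)) u"
        using u by (auto simp: u_eq scone_counit_def Hom_def intro!: i_eq)
      show "FArr scone_forget (scone_counit A B \<Phi> z u) = Ide B (FObj scone_forget u)"
        by (simp add: u_eq scone_counit_def)
    next
      fix K assume "K \<in> Arr ?S"
      moreover obtain a b f h k a' b' f' where "K = ((a, b, f), (h, k), (a', b', f'))"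
        by (metis surj_pair)
      ultimately show "K \<cdot>\<^bsub>?S\<^esub> scone_counit A B \<Phi> z (Dom ?S K) =
          scone_counit A B \<Phi> z (Cod ?S K) \<cdot>\<^bsub>?S\<^esub> FArr ?L (FArr scone_forget K)"
        by (auto simp: scone_counit_def intro!: i_eq)
    next
      show "scone_counit A B \<Phi> z (FObj ?L w) = Ide ?S (FObj ?L w)" if "w \<in> Obj B" for w
        using that by (auto simp: scone_counit_def intro!: i_eq)
    qed simp_all
    show "strict_coreflection_axioms ?S B ?L (scone_counit A B \<Phi> z)"
    proof
      fix K w assume K: "K \<in> Arr ?S" and w: "w \<in> Obj B" and cod: "Cod ?S K = FObj ?L w"
      obtain a b f h k where K_eq: "K = ((a, b, f), (h, k), FObj ?L w)"
        using cod by (cases K) auto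
      have a: "a \<in> Obj A" "b \<in> Obj B" and f: "f \<in> Arr A" "Dom A f = a" "Cod A f = FObj \<Phi> b"
        and h: "h \<in> Hom A a z"
        using K by (auto simp: K_eq Hom_def)
      obtain j where j: "j \<in> Arr A" "Dom A j = a" "Cod A j = z" "iso_arr A j"
        using strict h a by (auto simp: strict_initial_obj_def isomorphic_obj_def Hom_def)
      obtain j' where j': "j' \<in> Arr A" "Dom A j' = z" "Cod A j' = a"
        "j' \<cdot>\<^bsub>A\<^esub> j = Ide A a" "j \<cdot>\<^bsub>A\<^esub> j' = Ide A z"
        using j \<Phi>.Tgt.iso_arrE by metis
      have ij: "?i a = j'" by (rule i_eq) (use a j' in simp_all)
      have "?i (FObj \<Phi> b) \<cdot>\<^bsub>A\<^esub> j = (f \<cdot>\<^bsub>A\<^esub> j') \<cdot>\<^bsub>A\<^esub> j"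
        by (rule arg_cong[of _ _ "\<lambda>q. q \<cdot>\<^bsub>A\<^esub> j"], rule i_eq) (use a f j j' in simp_all)
      also have "\<dots> = f" using f j j' by simp
      finally have f_eq: "?i (FObj \<Phi> b) \<cdot>\<^bsub>A\<^esub> j = f" .
      have f_j': "f \<cdot>\<^bsub>A\<^esub> j' = ?i (FObj \<Phi> b)"
        by (rule i_eq) (use a f j' in simp_all)
      show "iso_arr ?S (scone_counit A B \<Phi> z (Dom ?S K))"
        by (rule S.iso_arrI[of _ "FObj ?L b" "(a, b, f)" "((a, b, f), (j, Ide B b), FObj ?L b)"])
          (use a f j j' f_eq f_j' in \<open>simp_all add: K_eq scone_counit_def ij Hom_def\<close>)
    qed
  qed
qed

theorem lemma22:
  fixes A :: "('a, 'm) cat" and B :: "('b, 'n) cat" and \<Phi> :: "('b, 'n, 'a, 'm) functr"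
  assumes "category A"
    and "\<exists>z. strict_initial_obj A z"
    and "category B"
    and "is_functor B A \<Phi>"
  shows "preserves_effective_descent (scone A B \<Phi>) B scone_forget"
proof -
  obtain z where "strict_initial_obj A z" using assms(2) by blast
  then interpret strict_coreflection "scone A B \<Phi>" B "scone_L A B \<Phi> z" scone_forget
      "scone_counit A B \<Phi> z"
    by (rule strict_coreflection_scone[OF assms(4)])
  show ?thesis by (rule U_preserves_effective_descent)
qed

end
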